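(* For every integer $p > 0$ and every integer $d \geq 5$, there exists a constant $C_p>0$ such that $M_{p,d}(n) \geq C_p n^{p/2+1/2}$ for all sufficiently large $n$.
   Context: For a finite set $S \subset \mathbb{R}^d$, the Vietoris–Rips complex $R(S)$ is the simplicial complex on vertex set $S$ whose faces are all subsets of $S$ of (Euclidean) diameter at most $1$. For a fixed field $\mathbf{k}$, $\tilde{\beta}_p(\Gamma)=\dim_{\mathbf{k}}\tilde{H}_p(\Gamma;\mathbf{k})$ denotes the $p$-th reduced Betti number. Define $M_{p,d}(n) := \max\{\tilde{\beta}_p(R(S)) : S \subset \mathbb{R}^d,\ |S| \leq n\}$. *)

theory Defs
  imports
    "HOL-Analysis.Abstract_Euclidean_Space"
    "HOL-Analysis.L2_Norm"
    "HOL-Combinatorics.Permutations"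
    "HOL-Algebra.AbelCoset"
    "Jordan_Normal_Form.VS_Connect"
begin

text \<open>
  Reduced simplicial homology with coefficients in a field. A simplicial complex is the set of
  its faces, the empty face included.

  An oriented chain is a finitely supported function on the orderings of the faces with \<open>m\<close>
  vertices (faces of dimension \<open>m - 1\<close>) that changes by the sign of the permutation when
  the vertices are reordered. Only orderings without repetition carry a value, so this is the
  usual space of oriented chains in every characteristic, including 2.
\<close>

definition oriented_chains :: "'v set set \<Rightarrow> nat \<Rightarrow> ('v list \<Rightarrow> 'k::field) set" where
  "oriented_chains K m =
     {c. finite {vs. c vs \<noteq> 0} \<and>
         (\<forall>vs. c vs \<noteq> 0 \<longrightarrow> distinct vs \<and> length vs = m \<and> set vs \<in> K) \<and>
         (\<forall>vs \<pi>. \<pi> permutes {..<length vs} \<longrightarrow>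
            c (permute_list \<pi> vs) = of_int (sign \<pi>) * c vs)}"

text \<open>
  The boundary \<open>\<partial>[v\<^sub>0,\<dots>,v\<^sub>q] = (\<Sum>i\<le>q. (-1)^i [v\<^sub>0,\<dots>,v\<^sub>i\<^sub>-\<^sub>1,v\<^sub>i\<^sub>+\<^sub>1,\<dots>,v\<^sub>q])\<close>, read off
  coefficientwise: the oriented simplex \<open>[y\<^sub>1,\<dots>,y\<^sub>q]\<close> arises from the simplices
  \<open>[v,y\<^sub>1,\<dots>,y\<^sub>q]\<close>, each time by deleting the leading vertex, hence with sign \<open>+1\<close>.
  For \<open>q = 0\<close> this is the augmentation, the coefficient of the empty face being the sum of the
  coefficients of the vertices.
\<close>

definition chain_boundary :: "('v list \<Rightarrow> 'k::field) \<Rightarrow> 'v list \<Rightarrow> 'k" where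
  "chain_boundary c = (\<lambda>vs. \<Sum>v | c (v # vs) \<noteq> 0. c (v # vs))"

definition simplicial_cycles :: "nat \<Rightarrow> 'v set set \<Rightarrow> ('v list \<Rightarrow> 'k::field) set" where
  "simplicial_cycles p K = {c \<in> oriented_chains K (p + 1). chain_boundary c = (\<lambda>_. 0)}"

definition simplicial_boundaries :: "nat \<Rightarrow> 'v set set \<Rightarrow> ('v list \<Rightarrow> 'k::field) set" where
  "simplicial_boundaries p K = chain_boundary ` oriented_chains K (p + 2)"

definition cycle_space :: "nat \<Rightarrow> 'v set set \<Rightarrow> ('k::field, 'v list \<Rightarrow> 'k) module" where
  "cycle_space p K =
     \<lparr>carrier = simplicial_cycles p K, monoid.mult = undefined, one = undefined,
      zero = (\<lambda>_. 0), add = (\<lambda>c c' vs. c vs + c' vs), module.smult = (\<lambda>a c vs. a * c vs)\<rparr>"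

definition quotient_module :: "('a, 'b, 'm) module_scheme \<Rightarrow> 'b set \<Rightarrow> ('a, 'b set) module" where
  "quotient_module M N =
     \<lparr>carrier = a_rcosets\<^bsub>M\<^esub> N, monoid.mult = undefined, one = undefined,
      zero = N, add = set_add M,
      module.smult = (\<lambda>a X. \<Union>x\<in>X. N +>\<^bsub>M\<^esub> (a \<odot>\<^bsub>M\<^esub> x))\<rparr>"

definition reduced_homology :: "nat \<Rightarrow> 'v set set \<Rightarrow> ('k::field, ('v list \<Rightarrow> 'k) set) module" where
  "reduced_homology p K = quotient_module (cycle_space p K) (simplicial_boundaries p K)"

definition reduced_betti :: "'k::field itself \<Rightarrow> nat \<Rightarrow> 'v set set \<Rightarrow> nat" where
  "reduced_betti _ p K =
     vectorspace.dim (class_ring :: 'k ring) (reduced_homology p K :: ('k, ('v list \<Rightarrow> 'k) set) module)"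

text \<open>
  Points of \<open>\<real>\<^sup>d\<close> are the elements of \<open>topspace (Euclidean_space d)\<close>, i.e. real sequences that
  vanish from index \<open>d\<close> on. This keeps \<open>d\<close> a number that can be quantified over.
\<close>

definition euclidean_dist :: "nat \<Rightarrow> (nat \<Rightarrow> real) \<Rightarrow> (nat \<Rightarrow> real) \<Rightarrow> real" where
  "euclidean_dist d x y = L2_set (\<lambda>i. x i - y i) {..<d}"

definition euclidean_diameter :: "nat \<Rightarrow> (nat \<Rightarrow> real) set \<Rightarrow> real" where
  "euclidean_diameter d A =
     (if A = {} then 0 else (SUP (x, y)\<in>A \<times> A. euclidean_dist d x y))"

definition vietoris_rips :: "nat \<Rightarrow> (nat \<Rightarrow> real) set \<Rightarrow> (nat \<Rightarrow> real) set set" where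
  "vietoris_rips d S = {\<sigma>. \<sigma> \<subseteq> S \<and> euclidean_diameter d \<sigma> \<le> 1}"

definition max_rips_betti :: "'k::field itself \<Rightarrow> nat \<Rightarrow> nat \<Rightarrow> nat \<Rightarrow> nat" where
  "max_rips_betti k p d n =
     Max {reduced_betti k p (vietoris_rips d S) | S.
            S \<subseteq> topspace (Euclidean_space d) \<and> finite S \<and> card S \<le> n}"

end

theory Submission
  imports Defs
begin

text \<open>
  The coefficient of a \<open>p\<close>-cycle at a maximal \<open>p\<close>-simplex depends only on its homology class. So
  \<open>\<beta>\<^sub>p\<close> is at least the number of maximal \<open>p\<close>-simplices \<open>v\<^sub>0,\<dots>,v\<^sub>p\<close> of a clique
  complex that can be completed by fixed vertices \<open>x\<^sub>0,\<dots>,x\<^sub>p\<close> to a cross-polytope with antipodal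
  pairs \<open>v\<^sub>s, x\<^sub>s\<close>.

  Such simplices are indexed by the \<open>m\<^sup>p\<^sup>+\<^sup>1\<close> functions \<open>f : {0..p} \<rightarrow> {0..<m}\<close>; each vertex remembers
  only two values of \<open>f\<close>, so that about \<open>(p + 1) m\<^sup>2\<close> points suffice. For odd \<open>p\<close> the vertex types
  come in pairs at the ends of diameters of a circle of diameter 1; the two vertices of a pair
  remember the same two values, and a perturbation orthogonal to the circle makes them adjacent
  exactly if these values agree. For even \<open>p\<close> there are in addition three types at the corners of
  an equilateral triangle of side 1 in an orthogonal plane; they remember \<open>(f\<^sub>0, f\<^sub>1)\<close>, \<open>(f\<^sub>1, f\<^sub>2)\<close>,
  \<open>(f\<^sub>2, f\<^sub>0)\<close>, and are perturbed such that two of them are adjacent exactly if they agree on the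
  value they share.
\<close>

section \<open>Quotients of spaces of functions\<close>

text \<open>The undefined ring fields copy those of \<open>cycle_space\<close>, so that the cycle
  space is literally an instance.\<close>

definition fun_module :: "('x \<Rightarrow> 'k::field) set \<Rightarrow> ('k, 'x \<Rightarrow> 'k) module" where
  "fun_module Z =
     \<lparr>carrier = Z, monoid.mult = undefined, one = undefined,
      zero = (\<lambda>_. 0), add = (\<lambda>c c' x. c x + c' x), module.smult = (\<lambda>a c x. a * c x)\<rparr>"

definition fun_subspace :: "('x \<Rightarrow> 'k::field) set \<Rightarrow> bool" where
  "fun_subspace Z \<longleftrightarrow> (\<lambda>_. 0) \<in> Z \<and> (\<forall>c\<in>Z. \<forall>c'\<in>Z. (\<lambda>x. c x + c' x) \<in> Z) \<and>
     (\<forall>a. \<forall>c\<in>Z. (\<lambda>x. a * c x) \<in> Z)"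

definition fun_coset :: "('x \<Rightarrow> 'k::field) set \<Rightarrow> ('x \<Rightarrow> 'k) \<Rightarrow> ('x \<Rightarrow> 'k) set" where
  "fun_coset B z = (\<lambda>b x. b x + z x) ` B"

lemma fun_subspaceD:
  assumes "fun_subspace Z"
  shows "(\<lambda>_. 0) \<in> Z" "c \<in> Z \<Longrightarrow> c' \<in> Z \<Longrightarrow> (\<lambda>x. c x + c' x) \<in> Z"
    "c \<in> Z \<Longrightarrow> (\<lambda>x. a * c x) \<in> Z"
  using assms unfolding fun_subspace_def by blast+

lemma fun_subspace_diff:
  assumes Z: "fun_subspace Z" and "c \<in> Z" "c' \<in> Z"
  shows "(\<lambda>x. c x - c' x) \<in> Z"
proof -
  have "(\<lambda>x. c x + (- 1) * c' x) \<in> Z"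
    by (intro fun_subspaceD(2)[OF Z] fun_subspaceD(3)[OF Z] assms)
  thus ?thesis by simp
qed

lemma fun_module_vectorspace:
  assumes Z: "fun_subspace Z"
  shows "vectorspace class_ring (fun_module Z)"
proof -
  note c = fun_subspaceD[OF Z]
  have "module class_ring (fun_module Z)"
  proof (rule moduleI)
    show "abelian_group (fun_module Z)"
    proof (rule abelian_groupI, goal_cases)
      case (6 x)
      then show ?case
        using c(3)[of x "-1"] by (intro bexI[of _ "\<lambda>y. - 1 * x y"]) (auto simp: fun_module_def)
    qed (auto simp: fun_module_def c algebra_simps)
  qed (auto simp: fun_module_def c algebra_simps class_cring.is_cring)
  thus ?thesis unfolding vectorspace_def using class_field by blast
qed

context
  fixes Z B :: "('x \<Rightarrow> 'k::field) set"
  assumes Z: "fun_subspace Z" and B: "fun_subspace B" and BZ: "B \<subseteq> Z"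
begin

lemma mem_fun_coset: "c \<in> fun_coset B z \<longleftrightarrow> (\<lambda>x. c x - z x) \<in> B"
proof
  assume "(\<lambda>x. c x - z x) \<in> B"
  thus "c \<in> fun_coset B z" unfolding fun_coset_def by (intro image_eqI) auto
qed (auto simp: fun_coset_def)

lemma fun_coset_eq_iff: "fun_coset B z = fun_coset B z' \<longleftrightarrow> (\<lambda>x. z x - z' x) \<in> B"
proof
  assume "fun_coset B z = fun_coset B z'"
  moreover have "z \<in> fun_coset B z" by (simp add: mem_fun_coset fun_subspaceD[OF B])
  ultimately show "(\<lambda>x. z x - z' x) \<in> B" using mem_fun_coset by blast
next
  assume d: "(\<lambda>x. z x - z' x) \<in> B"
  show "fun_coset B z = fun_coset B z'"
  proof (intro equalityI subsetI)
    fix c assume "c \<in> fun_coset B z"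
    hence "(\<lambda>x. c x - z x) \<in> B" by (simp add: mem_fun_coset)
    from fun_subspaceD(2)[OF B this d] show "c \<in> fun_coset B z'" by (simp add: mem_fun_coset)
  next
    fix c assume "c \<in> fun_coset B z'"
    hence "(\<lambda>x. c x - z' x) \<in> B" by (simp add: mem_fun_coset)
    from fun_subspace_diff[OF B this d] show "c \<in> fun_coset B z" by (simp add: mem_fun_coset)
  qed
qed

lemma a_r_coset_fun_module: "B +>\<^bsub>fun_module Z\<^esub> z = fun_coset B z"
  by (auto simp: a_r_coset_def' fun_coset_def fun_module_def)

lemma carrier_quotient: "carrier (quotient_module (fun_module Z) B) = fun_coset B ` Z"
proof -
  have "carrier (fun_module Z) = Z" by (simp add: fun_module_def)
  thus ?thesis
    by (auto simp: quotient_module_def A_RCOSETS_def' a_r_coset_fun_module)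
qed

lemma add_quotient:
  "fun_coset B z \<oplus>\<^bsub>quotient_module (fun_module Z) B\<^esub> fun_coset B z' =
     fun_coset B (\<lambda>x. z x + z' x)"
proof -
  have "fun_coset B z \<oplus>\<^bsub>quotient_module (fun_module Z) B\<^esub> fun_coset B z' =
      {\<lambda>x. c x + c' x | c c'. c \<in> fun_coset B z \<and> c' \<in> fun_coset B z'}"
    by (auto simp: quotient_module_def set_add_def' fun_module_def)
  also have "\<dots> = fun_coset B (\<lambda>x. z x + z' x)"
  proof (intro equalityI subsetI)
    fix d assume "d \<in> {\<lambda>x. c x + c' x | c c'. c \<in> fun_coset B z \<and> c' \<in> fun_coset B z'}"
    then obtain c c' where d: "d = (\<lambda>x. c x + c' x)"
      and "(\<lambda>x. c x - z x) \<in> B" "(\<lambda>x. c' x - z' x) \<in> B"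
      by (auto simp: mem_fun_coset)
    from fun_subspaceD(2)[OF B this(2,3)] show "d \<in> fun_coset B (\<lambda>x. z x + z' x)"
      by (simp add: mem_fun_coset d algebra_simps)
  next
    fix d assume "d \<in> fun_coset B (\<lambda>x. z x + z' x)"
    hence "(\<lambda>x. d x - z' x) \<in> fun_coset B z" by (simp add: mem_fun_coset algebra_simps)
    moreover have "z' \<in> fun_coset B z'" by (simp add: mem_fun_coset fun_subspaceD[OF B])
    ultimately show "d \<in> {\<lambda>x. c x + c' x | c c'. c \<in> fun_coset B z \<and> c' \<in> fun_coset B z'}"
      by force
  qed
  finally show ?thesis .
qed

text \<open>Scalar multiplication is a union over all representatives; closure of \<open>B\<close>
  under scaling makes the cosets in this union coincide.\<close>

lemma smult_quotient:
  "a \<odot>\<^bsub>quotient_module (fun_module Z) B\<^esub> fun_coset B z = fun_coset B (\<lambda>x. a * z x)"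
proof -
  have "fun_coset B (\<lambda>x. a * c x) = fun_coset B (\<lambda>x. a * z x)" if "c \<in> fun_coset B z" for c
  proof -
    have "(\<lambda>x. a * (c x - z x)) \<in> B"
      using that fun_subspaceD(3)[OF B] by (simp add: mem_fun_coset)
    thus ?thesis by (simp add: fun_coset_eq_iff algebra_simps)
  qed
  moreover have "z \<in> fun_coset B z" by (simp add: mem_fun_coset fun_subspaceD[OF B])
  moreover have "a \<odot>\<^bsub>quotient_module (fun_module Z) B\<^esub> fun_coset B z =
      (\<Union>c\<in>fun_coset B z. fun_coset B (\<lambda>x. a * c x))"
    by (simp add: quotient_module_def a_r_coset_fun_module) (simp add: fun_module_def)
  ultimately show ?thesis by blast
qed

lemma zero_quotient: "\<zero>\<^bsub>quotient_module (fun_module Z) B\<^esub> = fun_coset B (\<lambda>_. 0)"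
  by (simp add: quotient_module_def fun_coset_def)

lemma quotient_vectorspace: "vectorspace class_ring (quotient_module (fun_module Z) B)"
proof -
  let ?Q = "quotient_module (fun_module Z) B"
  note c = fun_subspaceD[OF Z]
  note q = carrier_quotient add_quotient smult_quotient zero_quotient
  have "module class_ring ?Q"
  proof (rule moduleI)
    show "abelian_group ?Q"
    proof (rule abelian_groupI, goal_cases)
      case (6 x)
      then obtain z where "x = fun_coset B z" "z \<in> Z" by (auto simp: q)
      then show ?case
        using c(3)[of z "-1"] by (intro bexI[of _ "fun_coset B (\<lambda>y. - 1 * z y)"]) (auto simp: q)
    qed (auto simp: q c algebra_simps)
  qed (auto simp: q c algebra_simps class_cring.is_cring)
  thus ?thesis unfolding vectorspace_def using class_field by blast
qed

lemma quotient_map_linear: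
  "linear_map class_ring (fun_module Z) (quotient_module (fun_module Z) B) (fun_coset B)"
proof -
  have "fun_coset B \<in> module_hom class_ring (fun_module Z) (quotient_module (fun_module Z) B)"
    unfolding module_hom_def carrier_quotient
    by (auto simp: fun_module_def) (auto simp: add_quotient smult_quotient simp flip: fun_module_def)
  thus ?thesis
    unfolding linear_map_def mod_hom_def mod_hom_axioms_def
    using fun_module_vectorspace[OF Z] quotient_vectorspace
    by (auto simp: vectorspace_def)
qed

end

section \<open>Dimension bounds for function spaces and their quotients\<close>

lemma (in linear_map) dim_codomain_le:
  assumes "V.fin_dim" "T ` carrier V = carrier W"
  shows "W.dim \<le> V.dim"
  using rank_nullity[OF assms(1)] surj_imp_imT_carrier[OF assms(2)] by simp

lemma finsum_fun_module:
  assumes Z: "fun_subspace Z" and "finite G" "f \<in> G \<rightarrow> Z"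
  shows "finsum (fun_module Z) f G = (\<lambda>x. \<Sum>g\<in>G. f g x)"
proof -
  interpret vectorspace class_ring "fun_module Z" by (rule fun_module_vectorspace[OF Z])
  show ?thesis using assms(2,3)
  proof (induction G rule: finite_induct)
    case (insert g G)
    then have "finsum (fun_module Z) f (insert g G) = f g \<oplus>\<^bsub>fun_module Z\<^esub> finsum (fun_module Z) f G"
      by (intro finsum_insert) (auto simp: fun_module_def)
    then show ?case using insert by (auto simp: fun_module_def)
  qed (simp, simp add: fun_module_def)
qed

text \<open>Gaussian elimination on the support: the functions vanishing at \<open>l\<close> have
  codimension at most one, so passing from \<open>L\<close> to \<open>insert l L\<close> costs at
  most one more generator.\<close>

lemma fun_subspace_generators:
  assumes "finite L" "fun_subspace Z" "\<forall>z\<in>Z. \<forall>x. x \<notin> L \<longrightarrow> z x = 0"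
  shows "\<exists>G. finite G \<and> G \<subseteq> Z \<and> card G \<le> card L \<and> (\<forall>z\<in>Z. \<exists>a. z = (\<lambda>x. \<Sum>g\<in>G. a g * g x))"
  using assms
proof (induction L arbitrary: Z rule: finite_induct)
  case empty
  then show ?case by (intro exI[of _ "{}"]) auto
next
  case (insert l L)
  define Z' where "Z' = {z\<in>Z. z l = 0}"
  have sub: "fun_subspace Z'" using insert.prems(1) by (auto simp: fun_subspace_def Z'_def)
  have supp: "\<forall>z\<in>Z'. \<forall>x. x \<notin> L \<longrightarrow> z x = 0"
    using insert.prems(2) by (auto simp: Z'_def)
  from insert.IH[OF sub supp] obtain G where
    "finite G \<and> G \<subseteq> Z' \<and> card G \<le> card L \<and> (\<forall>z\<in>Z'. \<exists>a. z = (\<lambda>x. \<Sum>g\<in>G. a g * g x))" ..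
  hence G: "finite G" "G \<subseteq> Z'" "card G \<le> card L"
    and span: "\<And>z. z \<in> Z' \<Longrightarrow> \<exists>a. z = (\<lambda>x. \<Sum>g\<in>G. a g * g x)"
    by simp_all
  show ?case
  proof (cases "Z' = Z")
    case True
    then show ?thesis using G span insert.hyps by (intro exI[of _ G]) auto
  next
    case False
    then obtain w where w: "w \<in> Z" "w l \<noteq> 0" by (auto simp: Z'_def)
    \<comment> \<open>Elements of \<open>G\<close> vanish at \<open>l\<close>, so the pivot
      \<open>w\<close> is new and its coefficient can be set without disturbing the others.\<close>
    have "w \<notin> G" using G(2) w by (auto simp: Z'_def)
    have "\<exists>a. z = (\<lambda>x. \<Sum>g\<in>insert w G. a g * g x)" if z: "z \<in> Z" for z
    proof -
      define b where "b = z l / w l"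
      have "(\<lambda>x. z x - b * w x) \<in> Z'"
        using fun_subspace_diff[OF insert.prems(1) z fun_subspaceD(3)[OF insert.prems(1) w(1), of b]] w(2)
        unfolding Z'_def by (simp add: b_def)
      from span[OF this] obtain a where a: "(\<lambda>x. z x - b * w x) = (\<lambda>x. \<Sum>g\<in>G. a g * g x)" ..
      have "z x = (\<Sum>g\<in>insert w G. (a(w := b)) g * g x)" for x
      proof -
        have "(\<Sum>g\<in>insert w G. (a(w := b)) g * g x) = b * w x + (\<Sum>g\<in>G. (a(w := b)) g * g x)"
          using G(1) \<open>w \<notin> G\<close> by simp
        also have "(\<Sum>g\<in>G. (a(w := b)) g * g x) = (\<Sum>g\<in>G. a g * g x)"
          using \<open>w \<notin> G\<close> by (intro sum.cong) auto
        also have "\<dots> = z x - b * w x" using fun_cong[OF a, of x] by simp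
        finally show ?thesis by simp
      qed
      thus ?thesis by blast
    qed
    then show ?thesis
      using G w insert.hyps \<open>w \<notin> G\<close> by (intro exI[of _ "insert w G"]) (auto simp: Z'_def)
  qed
qed

lemma fun_module_fin_dim:
  assumes L: "finite L" and Z: "fun_subspace Z" and supp: "\<forall>z\<in>Z. \<forall>x. x \<notin> L \<longrightarrow> z x = 0"
  shows "vectorspace.fin_dim class_ring (fun_module Z)"
    and "vectorspace.dim class_ring (fun_module Z) \<le> card L"
proof -
  interpret vectorspace class_ring "fun_module Z" by (rule fun_module_vectorspace[OF Z])
  have car: "carrier (fun_module Z) = Z" by (simp add: fun_module_def)
  from fun_subspace_generators[OF assms] obtain G where
    "finite G \<and> G \<subseteq> Z \<and> card G \<le> card L \<and> (\<forall>z\<in>Z. \<exists>a. z = (\<lambda>x. \<Sum>g\<in>G. a g * g x))" ..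
  hence G: "finite G" "G \<subseteq> Z" "card G \<le> card L"
    and span: "\<And>z. z \<in> Z \<Longrightarrow> \<exists>a. z = (\<lambda>x. \<Sum>g\<in>G. a g * g x)" by simp_all
  have lc: "lincomb a G = (\<lambda>x. \<Sum>g\<in>G. a g * g x)" for a
    unfolding lincomb_def using G fun_subspaceD(3)[OF Z]
    by (subst finsum_fun_module[OF Z]) (auto simp: fun_module_def)
  have "z \<in> span G" if z: "z \<in> Z" for z
  proof -
    obtain a where "z = (\<lambda>x. \<Sum>g\<in>G. a g * g x)" using span[OF z] ..
    hence "z = lincomb a G" by (simp only: lc)
    thus ?thesis unfolding span_def mem_Collect_eq using G(1) by (intro exI[of _ a] exI[of _ G]) auto
  qed
  hence gen: "gen_set G" using span_is_subset2[of G] G(2) car by auto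
  show "fin_dim" unfolding fin_dim_def using G gen car by auto
  show "dim \<le> card L" using gen_ge_dim[OF G(1) _ gen] G car by auto
qed

lemma quotient_fin_dim:
  assumes "fun_subspace Z" "fun_subspace B" "B \<subseteq> Z"
    and "finite L" "\<forall>z\<in>Z. \<forall>x. x \<notin> L \<longrightarrow> z x = 0"
  shows "vectorspace.fin_dim class_ring (quotient_module (fun_module Z) B)"
    and "vectorspace.dim class_ring (quotient_module (fun_module Z) B) \<le> card L"
proof -
  interpret linear_map class_ring "fun_module Z" "quotient_module (fun_module Z) B" "fun_coset B"
    by (rule quotient_map_linear[OF assms(1-3)])
  have s: "fun_coset B ` carrier (fun_module Z) = carrier (quotient_module (fun_module Z) B)"
    using carrier_quotient[OF assms(1-3)] by (simp add: fun_module_def)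
  have fd: "V.fin_dim" and d: "V.dim \<le> card L"
    using fun_module_fin_dim[OF assms(4,1,5)] by auto
  show "W.fin_dim" by (rule surj_fin_dim[OF fd s])
  show "W.dim \<le> card L" using dim_codomain_le[OF fd s] d by simp
qed

text \<open>Evaluation at the points \<open>y i\<close> annihilates \<open>B\<close>, hence descends
  to the quotient, and the functions \<open>z i\<close> dual to these points make it surjective onto
  a space of dimension \<open>card I\<close>.\<close>

lemma quotient_dim_lower_bound:
  fixes z :: "'i \<Rightarrow> 'x \<Rightarrow> 'k::field"
  assumes "fun_subspace Z" "fun_subspace B" "B \<subseteq> Z"
    and "finite L" "\<forall>z\<in>Z. \<forall>x. x \<notin> L \<longrightarrow> z x = 0"
    and I: "finite I" and z: "\<And>i. i \<in> I \<Longrightarrow> z i \<in> Z"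
    and B0: "\<And>b i. b \<in> B \<Longrightarrow> i \<in> I \<Longrightarrow> b (y i) = 0"
    and dual: "\<And>i j. i \<in> I \<Longrightarrow> j \<in> I \<Longrightarrow> z i (y j) = (if i = j then 1 else 0)"
  shows "card I \<le> vectorspace.dim class_ring (quotient_module (fun_module Z) B)"
proof -
  let ?Q = "quotient_module (fun_module Z) B" and ?n = "card I"
  obtain h where h: "bij_betw h {0..<?n} I" using ex_bij_betw_nat_finite[OF I] by blast
  hence hI: "h r \<in> I" if "r < ?n" for r using that by (auto simp: bij_betw_def)
  define R where "R c = vec ?n (\<lambda>r. c (y (h r)))" for c :: "'x \<Rightarrow> 'k"
  \<comment> \<open>The choice of representative is immaterial: \<open>R\<close> is constant on each
    coset, since elements of \<open>B\<close> vanish at the evaluation points.\<close>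
  define T where "T X = R (SOME c. c \<in> X)" for X
  have T: "T (fun_coset B c) = R c" for c
  proof -
    have "c \<in> fun_coset B c"
      by (simp add: mem_fun_coset[OF assms(1-3)] fun_subspaceD[OF assms(2)])
    hence "(SOME c'. c' \<in> fun_coset B c) \<in> fun_coset B c" by (rule someI[where P = "\<lambda>c'. c' \<in> fun_coset B c"])
    then obtain b where "b \<in> B" "(SOME c'. c' \<in> fun_coset B c) = (\<lambda>x. b x + c x)"
      by (auto simp: fun_coset_def)
    thus ?thesis using B0 hI by (auto simp: T_def R_def)
  qed
  note q = carrier_quotient[OF assms(1-3)] add_quotient[OF assms(1-3)] smult_quotient[OF assms(1-3)]
  have hom: "T \<in> module_hom class_ring ?Q (module_vec TYPE('k) ?n)"
    unfolding module_hom_def q by (auto simp: q T R_def module_vec_def)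
  interpret linear_map class_ring ?Q "module_vec TYPE('k) ?n" T
    unfolding linear_map_def mod_hom_def mod_hom_axioms_def
    using quotient_vectorspace[OF assms(1-3)] hom vec_vs[of ?n, where ?'a='k]
    by (auto simp: vectorspace_def)
  have "T ` carrier ?Q = carrier_vec ?n"
  proof (intro equalityI subsetI)
    fix w :: "'k vec" assume w: "w \<in> carrier_vec ?n"
    define c where "c = (\<lambda>x. \<Sum>r<?n. w $ r * z (h r) x)"
    have "(\<lambda>x. \<Sum>r<k. w $ r * z (h r) x) \<in> Z" if "k \<le> ?n" for k
      using that
    proof (induction k)
      case (Suc k)
      then show ?case
        using fun_subspaceD(2)[OF assms(1) Suc.IH fun_subspaceD(3)[OF assms(1) z[OF hI]]] by simp
    qed (simp add: fun_subspaceD[OF assms(1)])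
    hence "c \<in> Z" by (simp add: c_def)
    moreover have "R c = w"
    proof (rule eq_vecI)
      fix r assume "r < dim_vec w"
      hence r: "r < ?n" using w by simp
      have "c (y (h r)) = (\<Sum>q<?n. if q = r then w $ q else 0)"
        unfolding c_def using r h hI
        by (intro sum.cong) (auto simp: dual bij_betw_def inj_on_def)
      thus "R c $ r = w $ r" using r by (simp add: R_def)
    qed (use w in \<open>simp add: R_def\<close>)
    ultimately show "w \<in> T ` carrier ?Q" unfolding q using T[of c] by force
  qed (auto simp: q T R_def)
  hence "vectorspace.dim class_ring (module_vec TYPE('k) ?n) \<le> vectorspace.dim class_ring ?Q"
    using dim_codomain_le[OF quotient_fin_dim(1)[OF assms(1-5)]] by (simp add: module_vec_def)
  thus ?thesis using vec_space.dim_is_n[of ?n, where ?'a = 'k] by simp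
qed

section \<open>Homology of finite complexes\<close>

lemma oriented_chainsD:
  assumes "c \<in> oriented_chains K m"
  shows "c vs \<noteq> 0 \<Longrightarrow> distinct vs" "c vs \<noteq> 0 \<Longrightarrow> length vs = m" "c vs \<noteq> 0 \<Longrightarrow> set vs \<in> K"
    "\<pi> permutes {..<length vs} \<Longrightarrow> c (permute_list \<pi> vs) = of_int (sign \<pi>) * c vs"
  using assms unfolding oriented_chains_def by blast+

locale finite_complex =
  fixes S :: "'v set" and K :: "'v set set"
  assumes finite_S: "finite S" and faces: "\<And>\<sigma>. \<sigma> \<in> K \<Longrightarrow> \<sigma> \<subseteq> S"
    and down_closed: "\<And>\<sigma> \<tau>. \<sigma> \<in> K \<Longrightarrow> \<tau> \<subseteq> \<sigma> \<Longrightarrow> \<tau> \<in> K"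
begin

lemma finite_chain_support:
  assumes "\<And>vs. c vs \<noteq> (0::'k::field) \<Longrightarrow> length vs = m \<and> set vs \<in> K"
  shows "finite {vs. c vs \<noteq> 0}"
proof (rule finite_subset)
  show "{vs. c vs \<noteq> 0} \<subseteq> {vs. set vs \<subseteq> S \<and> length vs = m}" using assms faces by blast
  show "finite {vs. set vs \<subseteq> S \<and> length vs = m}" by (rule finite_lists_length_eq[OF finite_S])
qed

lemma oriented_chainsI:
  fixes c :: "'v list \<Rightarrow> 'k::field"
  assumes "\<And>vs. c vs \<noteq> 0 \<Longrightarrow> distinct vs \<and> length vs = m \<and> set vs \<in> K"
    and "\<And>vs \<pi>. \<pi> permutes {..<length vs} \<Longrightarrow> c (permute_list \<pi> vs) = of_int (sign \<pi>) * c vs"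
  shows "c \<in> oriented_chains K m"
  unfolding oriented_chains_def using assms finite_chain_support[of c m] by blast

lemma fun_subspace_oriented_chains: "fun_subspace (oriented_chains K m :: ('v list \<Rightarrow> 'k::field) set)"
  unfolding fun_subspace_def
proof (intro conjI ballI allI)
  show "(\<lambda>_. 0) \<in> (oriented_chains K m :: ('v list \<Rightarrow> 'k) set)" by (rule oriented_chainsI) auto
next
  fix c c' :: "'v list \<Rightarrow> 'k" assume c: "c \<in> oriented_chains K m" "c' \<in> oriented_chains K m"
  show "(\<lambda>x. c x + c' x) \<in> oriented_chains K m"
  proof (rule oriented_chainsI)
    fix vs assume "c vs + c' vs \<noteq> 0"
    hence "c vs \<noteq> 0 \<or> c' vs \<noteq> 0" by auto
    thus "distinct vs \<and> length vs = m \<and> set vs \<in> K"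
      using oriented_chainsD(1-3)[OF c(1), of vs] oriented_chainsD(1-3)[OF c(2), of vs] by blast
  qed (simp add: oriented_chainsD(4)[OF c(1)] oriented_chainsD(4)[OF c(2)] algebra_simps)
next
  fix a and c :: "'v list \<Rightarrow> 'k" assume c: "c \<in> oriented_chains K m"
  show "(\<lambda>x. a * c x) \<in> oriented_chains K m"
  proof (rule oriented_chainsI)
    fix vs assume "a * c vs \<noteq> 0"
    thus "distinct vs \<and> length vs = m \<and> set vs \<in> K"
      using oriented_chainsD(1-3)[OF c(1), of vs] by auto
  qed (simp add: oriented_chainsD(4)[OF c(1)] algebra_simps)
qed

text \<open>The index set in the definition of \<open>chain_boundary\<close> varies with
  \<open>c\<close>; summing over the fixed set \<open>S\<close> makes linearity visible.\<close>

lemma chain_boundary_eq_sum: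
  assumes "c \<in> oriented_chains K m"
  shows "chain_boundary c vs = (\<Sum>v\<in>S. c (v # vs))"
  unfolding chain_boundary_def
proof (rule sum.mono_neutral_left)
  show "{v. c (v # vs) \<noteq> 0} \<subseteq> S"
    using oriented_chainsD(3)[OF assms] faces by fastforce
qed (auto simp: finite_S)

lemma chain_boundary_add:
  assumes "c \<in> oriented_chains K m" "c' \<in> oriented_chains K m"
  shows "chain_boundary (\<lambda>x. c x + c' x) = (\<lambda>x. chain_boundary c x + chain_boundary c' x)"
  using fun_subspaceD(2)[OF fun_subspace_oriented_chains assms] assms
  by (simp add: fun_eq_iff chain_boundary_eq_sum[of _ m] sum.distrib)

lemma chain_boundary_smult:
  assumes "c \<in> oriented_chains K m"
  shows "chain_boundary (\<lambda>x. a * c x) = (\<lambda>x. a * chain_boundary c x)"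
  using fun_subspaceD(3)[OF fun_subspace_oriented_chains assms, of a] assms
  by (simp add: fun_eq_iff chain_boundary_eq_sum[of _ m] sum_distrib_left)

lemma fun_subspace_cycles: "fun_subspace (simplicial_cycles p K :: ('v list \<Rightarrow> 'k::field) set)"
proof -
  have "chain_boundary (\<lambda>_. 0) = (\<lambda>_::'v list. 0::'k)" by (simp add: chain_boundary_def)
  thus ?thesis
    using fun_subspace_oriented_chains[of "p + 1", where ?'k = 'k]
    unfolding fun_subspace_def simplicial_cycles_def
    by (auto simp: chain_boundary_add[of _ "Suc p"] chain_boundary_smult[of _ "Suc p"])
qed

lemma fun_subspace_boundaries:
  "fun_subspace (simplicial_boundaries p K :: ('v list \<Rightarrow> 'k::field) set)"
proof -
  note c = fun_subspaceD[OF fun_subspace_oriented_chains[of "p + 2", where ?'k = 'k]]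
  show ?thesis unfolding fun_subspace_def simplicial_boundaries_def
  proof (intro conjI ballI allI; (elim imageE)?)
    show "(\<lambda>_. 0) \<in> chain_boundary ` (oriented_chains K (p + 2) :: ('v list \<Rightarrow> 'k) set)"
      using c(1) by (intro image_eqI[where x = "\<lambda>_. 0"]) (auto simp: chain_boundary_def)
  next
    fix b b' and c c' :: "'v list \<Rightarrow> 'k"
    assume "c \<in> oriented_chains K (p + 2)" "c' \<in> oriented_chains K (p + 2)"
      "b = chain_boundary c" "b' = chain_boundary c'"
    thus "(\<lambda>x. b x + b' x) \<in> chain_boundary ` oriented_chains K (p + 2)"
      using c(2)[of c c'] by (intro image_eqI[where x = "\<lambda>x. c x + c' x"]) (auto simp: chain_boundary_add[of _ "p + 2"])
  next
    fix a b and c' :: "'v list \<Rightarrow> 'k"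
    assume "c' \<in> oriented_chains K (p + 2)" "b = chain_boundary c'"
    thus "(\<lambda>x. a * b x) \<in> chain_boundary ` oriented_chains K (p + 2)"
      using c(3)[of c' a] by (intro image_eqI[where x = "\<lambda>x. a * c' x"]) (auto simp: chain_boundary_smult[of _ "p + 2"])
  qed
qed

end

text \<open>In characteristic 2 antisymmetry alone does not kill the diagonal terms.\<close>

lemma sum_antisymmetric:
  fixes g :: "'a \<Rightarrow> 'a \<Rightarrow> 'k::field"
  assumes "finite A" "\<And>x y. g x y = - g y x" "\<And>x. g x x = 0"
  shows "(\<Sum>x\<in>A. \<Sum>y\<in>A. g x y) = 0"
  using assms(1)
proof (induction A rule: finite_induct)
  case (insert a A)
  have "(\<Sum>x\<in>A. g x a) = - (\<Sum>x\<in>A. g a x)"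
    by (subst assms(2)) (simp add: sum_negf)
  then show ?case using insert by (simp add: assms(3) sum.distrib)
qed simp

text \<open>The boundary evaluates a chain at \<open>v # vs\<close>, so a reordering of
  \<open>vs\<close> has to be lifted to one that fixes the head and has the same sign.\<close>

lemma permute_list_Cons:
  assumes "\<pi> permutes {..<length vs}"
  obtains \<pi>' where "\<pi>' permutes {..<length (v # vs)}" "sign \<pi>' = sign \<pi>"
    "permute_list \<pi>' (v # vs) = v # permute_list \<pi> vs"
proof -
  define \<pi>' where "\<pi>' = map_permutation {..<length vs} Suc \<pi>"
  have p: "\<pi>' permutes Suc ` {..<length vs}"
    unfolding \<pi>'_def by (intro map_permutation_permutes assms inj_on_imp_bij_betw) simp
  show ?thesis
  proof
    show p': "\<pi>' permutes {..<length (v # vs)}" by (rule permutes_subset[OF p]) auto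
    show "sign \<pi>' = sign \<pi>" unfolding \<pi>'_def by (intro sign_map_permutation assms) auto
    have "\<pi>' 0 = 0" by (rule permutes_not_in[OF p]) auto
    moreover have "\<pi>' (Suc i) = Suc (\<pi> i)" if "i < length vs" for i
      unfolding \<pi>'_def using that by (intro map_permutation_apply) auto
    ultimately show "permute_list \<pi>' (v # vs) = v # permute_list \<pi> vs"
      using permute_list_nth[OF p'] permute_list_nth[OF assms]
      by (intro nth_equalityI) (auto simp: nth_Cons split: nat.splits)
  qed
qed

context finite_complex
begin

lemma chain_boundary_closed:
  fixes c :: "'v list \<Rightarrow> 'k::field"
  assumes c: "c \<in> oriented_chains K (Suc m)"
  shows "chain_boundary c \<in> oriented_chains K m"
proof (rule oriented_chainsI)
  fix vs assume "chain_boundary c vs \<noteq> 0"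
  then obtain v where "c (v # vs) \<noteq> 0"
    unfolding chain_boundary_eq_sum[OF c] by (metis (mono_tags, lifting) sum.neutral)
  from oriented_chainsD(1-3)[OF c this] show "distinct vs \<and> length vs = m \<and> set vs \<in> K"
    using down_closed[of "set (v # vs)" "set vs"] by auto
next
  fix vs \<pi> assume \<pi>: "\<pi> permutes {..<length (vs :: 'v list)}"
  have "c (v # permute_list \<pi> vs) = of_int (sign \<pi>) * c (v # vs)" for v
    using permute_list_Cons[OF \<pi>, of v] oriented_chainsD(4)[OF c] by metis
  thus "chain_boundary c (permute_list \<pi> vs) = of_int (sign \<pi>) * chain_boundary c vs"
    by (simp add: chain_boundary_eq_sum[OF c] sum_distrib_left)
qed

text \<open>The coefficient at \<open>vs\<close> is the double sum of \<open>c (x # y # vs)\<close>.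
  Swapping the first two entries changes the sign, and lists with a repeated entry carry the value
  0.\<close>

lemma chain_boundary_boundary:
  fixes c :: "'v list \<Rightarrow> 'k::field"
  assumes c: "c \<in> oriented_chains K (Suc m)"
  shows "chain_boundary (chain_boundary c) = (\<lambda>_. 0)"
proof
  fix vs
  have "c (x # y # vs) = - c (y # x # vs)" for x y
  proof -
    let ?t = "Transposition.transpose (0::nat) 1"
    have t: "?t permutes {..<length (y # x # vs)}"
      by (rule permutes_swap_id) auto
    have "permute_list ?t (y # x # vs) = x # y # vs"
    proof (rule nth_equalityI)
      fix i assume "i < length (permute_list ?t (y # x # vs))"
      thus "permute_list ?t (y # x # vs) ! i = (x # y # vs) ! i"
        by (subst permute_list_nth[OF t])
          (auto simp: Transposition.transpose_def nth_Cons split: nat.splits)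
    qed simp
    with oriented_chainsD(4)[OF c t] show ?thesis by (simp add: sign_swap_id)
  qed
  moreover have "c (x # x # vs) = 0" for x using oriented_chainsD(1)[OF c, of "x # x # vs"] by auto
  ultimately have "(\<Sum>y\<in>S. \<Sum>x\<in>S. c (x # y # vs)) = 0"
    by (intro sum_antisymmetric finite_S)
  thus "chain_boundary (chain_boundary c) vs = 0"
    by (simp add: chain_boundary_eq_sum[OF chain_boundary_closed[OF c]] chain_boundary_eq_sum[OF c])
qed

lemma boundaries_subset_cycles:
  "simplicial_boundaries p K \<subseteq> (simplicial_cycles p K :: ('v list \<Rightarrow> 'k::field) set)"
  using chain_boundary_closed[of _ "p + 1"] chain_boundary_boundary[of _ "p + 1"]
  by (auto simp: simplicial_boundaries_def simplicial_cycles_def)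

lemma cycle_support:
  "\<forall>z\<in>(simplicial_cycles p K :: ('v list \<Rightarrow> 'k::field) set). \<forall>vs.
     vs \<notin> {vs. set vs \<subseteq> S \<and> length vs = p + 1} \<longrightarrow> z vs = 0"
  unfolding simplicial_cycles_def using oriented_chainsD(2,3) faces by fastforce

lemma reduced_betti_eq:
  "reduced_betti TYPE('k::field) p K =
     vectorspace.dim class_ring
       (quotient_module (fun_module (simplicial_cycles p K)) (simplicial_boundaries p K :: ('v list \<Rightarrow> 'k) set))"
  by (simp add: reduced_betti_def reduced_homology_def cycle_space_def fun_module_def)

lemma reduced_betti_le: "reduced_betti TYPE('k::field) p K \<le> card S ^ (p + 1)"
  unfolding reduced_betti_eq card_lists_length_eq[OF finite_S, symmetric]
  by (intro quotient_fin_dim(2) fun_subspace_cycles fun_subspace_boundaries boundaries_subset_cycles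
      cycle_support finite_lists_length_eq finite_S)

text \<open>Boundaries vanish on orderings of maximal faces, so evaluation there is well defined on
  homology classes.\<close>

lemma card_le_reduced_betti:
  fixes z :: "'i \<Rightarrow> 'v list \<Rightarrow> 'k::field"
  assumes "finite I" and "\<And>i. i \<in> I \<Longrightarrow> z i \<in> simplicial_cycles p K"
    and maximal: "\<And>i w. i \<in> I \<Longrightarrow> insert w (set (y i)) \<in> K \<Longrightarrow> w \<in> set (y i)"
    and "\<And>i j. i \<in> I \<Longrightarrow> j \<in> I \<Longrightarrow> z i (y j) = (if i = j then 1 else 0)"
  shows "card I \<le> reduced_betti TYPE('k) p K"
  unfolding reduced_betti_eq
proof (rule quotient_dim_lower_bound[OF fun_subspace_cycles fun_subspace_boundaries
      boundaries_subset_cycles finite_lists_length_eq[OF finite_S] cycle_support assms(1),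
      where z = z and y = y])
  fix b :: "'v list \<Rightarrow> 'k" and i assume "b \<in> simplicial_boundaries p K" "i \<in> I"
  then obtain c where c: "c \<in> oriented_chains K (p + 2)" and b: "b = chain_boundary c"
    by (auto simp: simplicial_boundaries_def)
  \<comment> \<open>A nonzero value would make \<open>w\<close> a new vertex completing a larger
    face.\<close>
  have "c (w # y i) = 0" for w
    using oriented_chainsD(1,3)[OF c, of "w # y i"] maximal[OF \<open>i \<in> I\<close>] by auto
  thus "b (y i) = 0" by (simp add: b chain_boundary_def)
qed (use assms(2,4) in simp_all)

end

section \<open>Cross-polytopes in clique complexes\<close>

text \<open>Column \<open>s\<close> evaluates the 0-sphere \<open>v s - x s\<close> at the listed
  vertices. Rows follow the list, so that reordering produces the orientation sign and repeated
  vertices produce equal rows.\<close>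

definition cross_matrix :: "nat \<Rightarrow> (nat \<Rightarrow> 'v) \<Rightarrow> (nat \<Rightarrow> 'v) \<Rightarrow> 'v list \<Rightarrow> 'k::field mat" where
  "cross_matrix n v x vs = mat n n (\<lambda>(r, s). of_bool (vs ! r = v s) - of_bool (vs ! r = x s))"

text \<open>The join of the 0-spheres \<open>v s - x s\<close>, i.e. their product in the exterior algebra.\<close>

definition cross_polytope_chain :: "nat \<Rightarrow> (nat \<Rightarrow> 'v) \<Rightarrow> (nat \<Rightarrow> 'v) \<Rightarrow> 'v list \<Rightarrow> 'k::field" where
  "cross_polytope_chain n v x vs = (if length vs = n then det (cross_matrix n v x vs) else 0)"

lemma cross_matrix_carrier [simp]: "cross_matrix n v x vs \<in> carrier_mat n n"
  by (simp add: cross_matrix_def)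

text \<open>A nonzero determinant has a nonzero Leibniz term, whose permutation assigns to each
  position its own antipodal pair.\<close>

lemma cross_polytope_chain_support:
  assumes "cross_polytope_chain n v x vs \<noteq> (0::'k::field)"
  obtains \<pi> where "\<pi> permutes {0..<n}" "length vs = n" "\<And>r. r < n \<Longrightarrow> vs ! r = v (\<pi> r) \<or> vs ! r = x (\<pi> r)"
proof -
  have n: "length vs = n" and "det (cross_matrix n v x vs :: 'k mat) \<noteq> 0"
    using assms by (auto simp: cross_polytope_chain_def split: if_splits)
  then obtain \<pi> where \<pi>: "\<pi> permutes {0..<n}"
    and nz: "signof \<pi> * (\<Prod>r = 0..<n. (cross_matrix n v x vs :: 'k mat) $$ (r, \<pi> r)) \<noteq> 0"
    unfolding det_def'[OF cross_matrix_carrier]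
    by (metis (mono_tags, lifting) mem_Collect_eq sum.neutral)
  have "vs ! r = v (\<pi> r) \<or> vs ! r = x (\<pi> r)" if "r < n" for r
  proof -
    have "(cross_matrix n v x vs :: 'k mat) $$ (r, \<pi> r) \<noteq> 0" using nz that by auto
    moreover have "\<pi> r < n" using permutes_in_image[OF \<pi>, of r] that by simp
    ultimately show ?thesis using that by (auto simp: cross_matrix_def split: if_splits)
  qed
  with \<pi> n show ?thesis using that by blast
qed

lemma cross_polytope_chain_distinct:
  assumes "cross_polytope_chain n v x vs \<noteq> (0::'k::field)"
  shows "distinct vs"
proof (rule ccontr)
  assume "\<not> distinct vs"
  then obtain i j where ij: "i < length vs" "j < length vs" "i \<noteq> j" "vs ! i = vs ! j"
    by (auto simp: distinct_conv_nth)
  have n: "length vs = n" using assms by (auto simp: cross_polytope_chain_def split: if_splits)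
  have "det (cross_matrix n v x vs :: 'k mat) = 0"
    using ij n by (intro det_identical_rows[OF _ ij(3)]) (auto simp: cross_matrix_def)
  thus False using assms n unfolding cross_polytope_chain_def by simp
qed

lemma cross_polytope_chain_permute:
  assumes \<pi>: "\<pi> permutes {..<length vs}"
  shows "cross_polytope_chain n v x (permute_list \<pi> vs) =
    of_int (sign \<pi>) * (cross_polytope_chain n v x vs :: 'k::field)"
proof (cases "length vs = n")
  case True
  hence p: "\<pi> permutes {0..<n}" using \<pi> by (simp add: atLeast0LessThan)
  have "cross_matrix n v x (permute_list \<pi> vs) =
      (mat n n (\<lambda>(i, j). cross_matrix n v x vs $$ (\<pi> i, j)) :: 'k mat)"
    using permutes_in_image[OF p] True
    by (intro eq_matI) (auto simp: cross_matrix_def permute_list_nth[OF \<pi>])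
  thus ?thesis using True det_permute_rows[OF cross_matrix_carrier p, of v x vs]
    by (simp add: cross_polytope_chain_def)
qed (simp add: cross_polytope_chain_def)

text \<open>Laplace expansion along the first row, the only one that depends on \<open>w\<close>:
  summed over \<open>w\<close>, its entries cancel, as \<open>v j\<close> and \<open>x j\<close>
  each occur once in \<open>S\<close>.\<close>

lemma sum_cross_polytope_chain:
  assumes "finite S" "\<And>s. s < n \<Longrightarrow> v s \<in> S" "\<And>s. s < n \<Longrightarrow> x s \<in> S" "n > 0"
  shows "(\<Sum>w\<in>S. cross_polytope_chain n v x (w # vs)) = (0::'k::field)"
proof (cases "length (undefined # vs) = n")
  case True
  \<comment> \<open>The first row is deleted in these cofactors, so \<open>undefined\<close> is a
    mere placeholder for the head.\<close>
  define C :: "nat \<Rightarrow> 'k" where "C j = cofactor (cross_matrix n v x (undefined # vs)) 0 j" for j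
  have cof: "cofactor (cross_matrix n v x (w # vs)) 0 j = C j" if "j < n" for w j
  proof -
    have "mat_delete (cross_matrix n v x (w # vs) :: 'k mat) 0 j =
        mat_delete (cross_matrix n v x (undefined # vs)) 0 j"
      using that by (intro eq_matI) (auto simp: mat_delete_def cross_matrix_def)
    thus ?thesis by (simp add: C_def cofactor_def)
  qed
  have "(\<Sum>w\<in>S. cross_polytope_chain n v x (w # vs)) =
      (\<Sum>w\<in>S. \<Sum>j<n. (of_bool (w = v j) - of_bool (w = x j)) * C j)"
    using True assms(4)
    by (intro sum.cong refl)
      (simp add: cross_polytope_chain_def laplace_expansion_row[OF cross_matrix_carrier assms(4)] cof,
       simp add: cross_matrix_def)
  also have "\<dots> = (\<Sum>j<n. (\<Sum>w\<in>S. of_bool (w = v j) - of_bool (w = x j)) * C j)"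
    by (subst sum.swap) (simp add: sum_distrib_right)
  also have "\<dots> = 0"
    using assms by (intro sum.neutral) (auto simp: sum_subtractf of_bool_def)
  finally show ?thesis .
qed (simp add: cross_polytope_chain_def)

section \<open>Betti numbers from families of cross-polytopes\<close>

definition clique_complex :: "'v set \<Rightarrow> ('v \<Rightarrow> 'v \<Rightarrow> bool) \<Rightarrow> 'v set set" where
  "clique_complex S adj = {\<sigma>. \<sigma> \<subseteq> S \<and> (\<forall>u\<in>\<sigma>. \<forall>w\<in>\<sigma>. adj u w)}"

lemma finite_complex_clique_complex: "finite S \<Longrightarrow> finite_complex S (clique_complex S adj)"
  by unfold_locales (auto simp: clique_complex_def)

text \<open>The cross-polytopes share the vertices \<open>x s\<close>, and each contributes the
  maximal face of its \<open>v f s\<close>. The cycle of \<open>f\<close> has coefficient 1 at its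
  own face and, by \<open>separated\<close>, 0 at the faces of the other indices.\<close>

lemma cross_polytope_betti_bound:
  fixes v :: "'i \<Rightarrow> nat \<Rightarrow> 'v" and x :: "nat \<Rightarrow> 'v" and p :: nat
  assumes S: "finite S" and sym: "\<And>u w. adj u w \<Longrightarrow> adj w u" and refl: "\<And>u. adj u u"
    and I: "finite I"
    and vS: "\<And>f s. f \<in> I \<Longrightarrow> s \<le> p \<Longrightarrow> v f s \<in> S" and xS: "\<And>s. s \<le> p \<Longrightarrow> x s \<in> S"
    and vv: "\<And>f s t. f \<in> I \<Longrightarrow> s \<le> p \<Longrightarrow> t \<le> p \<Longrightarrow> s \<noteq> t \<Longrightarrow> adj (v f s) (v f t)"
    and vx: "\<And>f s t. f \<in> I \<Longrightarrow> s \<le> p \<Longrightarrow> t \<le> p \<Longrightarrow> s \<noteq> t \<Longrightarrow> adj (v f s) (x t)"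
    and xx: "\<And>s t. s \<le> p \<Longrightarrow> t \<le> p \<Longrightarrow> s \<noteq> t \<Longrightarrow> adj (x s) (x t)"
    and antipodal: "\<And>f s. f \<in> I \<Longrightarrow> s \<le> p \<Longrightarrow> \<not> adj (v f s) (x s)"
    and separated: "\<And>f g. f \<in> I \<Longrightarrow> g \<in> I \<Longrightarrow> f \<noteq> g \<Longrightarrow> \<exists>s\<le>p. \<exists>t\<le>p. \<not> adj (v f s) (v g t)"
    and maximal: "\<And>f w. f \<in> I \<Longrightarrow> w \<in> S \<Longrightarrow> (\<forall>s\<le>p. adj w (v f s)) \<Longrightarrow> \<exists>s\<le>p. w = v f s"
  shows "card I \<le> reduced_betti TYPE('k::field) p (clique_complex S adj)"
proof -
  let ?K = "clique_complex S adj"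
  interpret finite_complex S ?K by (rule finite_complex_clique_complex[OF S])
  define z :: "'i \<Rightarrow> 'v list \<Rightarrow> 'k" where "z f = cross_polytope_chain (p + 1) (v f) x" for f
  define y where "y f = map (v f) [0..<p + 1]" for f
  \<comment> \<open>For \<open>s \<noteq> t\<close> an equality would make \<open>v f t\<close>
    adjacent to its own antipode \<open>x t\<close>.\<close>
  have v_ne_x: "v f s \<noteq> x t" if "f \<in> I" "s \<le> p" "t \<le> p" for f s t
  proof
    assume eq: "v f s = x t"
    show False
    proof (cases "s = t")
      case True
      thus False using antipodal[OF that(1,3)] eq refl by simp
    next
      case False
      thus False using antipodal[OF that(1,3)] vv[OF that(1,3,2)] eq by simp
    qed
  qed
  have y_nth: "y f ! s = v f s" if "s \<le> p" for f s
    using that unfolding y_def by (subst nth_map) (auto simp del: upt_Suc)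
  have y_set: "set (y f) = v f ` {..p}" for f
    by (simp add: y_def atLeast0LessThan lessThan_Suc_atMost del: upt_Suc)
  show ?thesis
  proof (rule card_le_reduced_betti[OF I, where z = z and y = y])
    fix f assume f: "f \<in> I"
    have chain: "z f \<in> oriented_chains ?K (p + 1)"
    proof (rule oriented_chainsI)
      fix vs assume nz: "z f vs \<noteq> 0"
      from cross_polytope_chain_support[OF nz[unfolded z_def]] obtain \<pi> where
        \<pi>: "\<pi> permutes {0..<p + 1}" and len: "length vs = p + 1"
        and vs: "\<And>r. r < p + 1 \<Longrightarrow> vs ! r = v f (\<pi> r) \<or> vs ! r = x (\<pi> r)" by blast
      have \<pi>_le: "\<pi> r \<le> p" if "r < p + 1" for r using permutes_in_image[OF \<pi>, of r] that by auto
      have "vs ! r \<in> S" if "r < p + 1" for r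
        using vs[OF that] vS[OF f \<pi>_le[OF that]] xS[OF \<pi>_le[OF that]] by auto
      moreover have "adj (vs ! q) (vs ! r)" if "q < p + 1" "r < p + 1" for q r
      proof (cases "q = r")
        case False
        hence "\<pi> q \<noteq> \<pi> r" using permutes_inj[OF \<pi>] by (auto simp: inj_def)
        hence "adj (v f (\<pi> q)) (v f (\<pi> r))" "adj (v f (\<pi> q)) (x (\<pi> r))"
          "adj (x (\<pi> q)) (v f (\<pi> r))" "adj (x (\<pi> q)) (x (\<pi> r))"
          using \<pi>_le[OF that(1)] \<pi>_le[OF that(2)] by (auto intro: vv[OF f] vx[OF f] xx sym[OF vx[OF f]])
        thus ?thesis using vs[OF that(1)] vs[OF that(2)] by auto
      qed (simp add: refl)
      ultimately have "set vs \<in> ?K"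
        unfolding clique_complex_def in_set_conv_nth[of _ vs] using len
        by (auto simp: in_set_conv_nth)
      thus "distinct vs \<and> length vs = p + 1 \<and> set vs \<in> ?K"
        using len cross_polytope_chain_distinct[OF nz[unfolded z_def]] by blast
    qed (simp add: z_def cross_polytope_chain_permute)
    have "chain_boundary (z f) = (\<lambda>_. 0)"
    proof
      fix vs
      show "chain_boundary (z f) vs = 0"
        unfolding chain_boundary_eq_sum[OF chain] unfolding z_def
        using vS[OF f] xS by (intro sum_cross_polytope_chain[OF S]) auto
    qed
    with chain show "z f \<in> simplicial_cycles p ?K" by (simp add: simplicial_cycles_def)
    show "w \<in> set (y f)" if "insert w (set (y f)) \<in> ?K" for w
      using that maximal[OF f, of w] by (auto simp: clique_complex_def y_set)
    fix g assume g: "g \<in> I"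
    show "z f (y g) = (if f = g then 1 else 0)"
    proof (cases "f = g")
      case True
      have "v f s = v f t \<longleftrightarrow> s = t" if "s \<le> p" "t \<le> p" for s t
        using antipodal[OF f that(1)] vx[OF f that(2,1)] by (cases "s = t") auto
      hence "cross_matrix (p + 1) (v f) x (y f) = (1\<^sub>m (p + 1) :: 'k mat)"
        using v_ne_x[OF f] by (intro eq_matI) (auto simp: cross_matrix_def y_nth)
      thus ?thesis using True by (simp add: z_def cross_polytope_chain_def y_def)
    next
      case False
      \<comment> \<open>Otherwise every \<open>v g r\<close>, not being one of the \<open>x\<close>,
        would be a vertex of the face of \<open>f\<close>, where any two vertices are
        adjacent.\<close>
      have "z f (y g) = 0"
      proof (rule ccontr)
        assume "z f (y g) \<noteq> 0"
        from cross_polytope_chain_support[OF this[unfolded z_def]] obtain \<pi> where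
          \<pi>: "\<pi> permutes {0..<p + 1}"
          and "\<And>r. r < p + 1 \<Longrightarrow> y g ! r = v f (\<pi> r) \<or> y g ! r = x (\<pi> r)" by blast
        moreover have \<pi>_le: "\<pi> r \<le> p" if "r \<le> p" for r
          using permutes_in_image[OF \<pi>, of r] that by auto
        ultimately have eq: "v g r = v f (\<pi> r)" if "r \<le> p" for r
          using that v_ne_x[OF g that \<pi>_le[OF that]] y_nth[OF that, of g] by (metis Suc_eq_plus1 le_imp_less_Suc)
        obtain s t where "s \<le> p" "t \<le> p" "\<not> adj (v f s) (v g t)" using separated[OF f g False] by blast
        thus False using eq[of t] \<pi>_le[of t] vv[OF f, of s "\<pi> t"] refl by metis
      qed
      thus ?thesis using False by simp
    qed
  qed
qed

section \<open>The point configuration\<close>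

text \<open>All points used vanish from coordinate 5 on, so this one function serves every
  \<open>d \<ge> 5\<close>; comparison with 1 is unaffected by squaring.\<close>

definition sqdist5 :: "(nat \<Rightarrow> real) \<Rightarrow> (nat \<Rightarrow> real) \<Rightarrow> real" where
  "sqdist5 x y = (\<Sum>c<5. (x c - y c)\<^sup>2)"

text \<open>
  Types \<open>0, 1, 2\<close> are the corners of the triangle in the plane of the coordinates 0 and 1, cyclically
  permuted by \<open>nxt\<close>. Types \<open>s \<ge> 3\<close> are the ends of diameters of the circle of radius \<open>1/2\<close> in the plane
  of the coordinates 2 and 3, with \<open>3, 4\<close> on the first diameter, \<open>5, 6\<close> on the second, and so on.
\<close>

definition nxt :: "nat \<Rightarrow> nat" where "nxt s = (s + 1) mod 3"

definition partner :: "nat \<Rightarrow> nat" where "partner s = (if odd s then s + 1 else s - 1)"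

text \<open>Distinct diameters get distinct values in (0, 1]; completed by a nonnegative
  \<open>dir_y\<close> they give pairwise non-parallel unit vectors.\<close>

definition dir_x :: "nat \<Rightarrow> real" where "dir_x s = 1 / real ((s - 3) div 2 + 1)"

definition dir_y :: "nat \<Rightarrow> real" where "dir_y s = sqrt (1 - (dir_x s)\<^sup>2)"

definition inradius :: real where "inradius = sqrt (1 / 12)"

lemma inradius_sq: "inradius * inradius = 1 / 12" "inradius * (inradius * a) = a / 12"
  by (simp_all add: inradius_def flip: mult.assoc)

definition base :: "nat \<Rightarrow> nat \<Rightarrow> real" where
  "base s c =
    (if s = 0 then [- 1 / 2, - inradius, 0, 0, 0] ! c
     else if s = 1 then [1 / 2, - inradius, 0, 0, 0] ! c
     else if s = 2 then [0, 2 * inradius, 0, 0, 0] ! c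
     else if odd s then [0, 0, dir_x s / 2, dir_y s / 2, 0] ! c
     else [0, 0, - dir_x s / 2, - dir_y s / 2, 0] ! c)"

text \<open>For a corner, at distance 1 / sqrt 3 from the centre, the factor must exceed sqrt 3 - 1
  to put the antipode farther than 1 away, and be at most 1 to keep the antipodes of two corners
  within distance 1.\<close>

definition antipode_scale :: "nat \<Rightarrow> real" where "antipode_scale s = (if s < 3 then 3 / 4 else 1)"

definition antipode :: "nat \<Rightarrow> nat \<Rightarrow> real" where
  "antipode s c = (if c < 5 then - antipode_scale s * base s c else 0)"

text \<open>
  Let \<open>P\<close>, \<open>Q\<close>, \<open>R\<close> be the corners \<open>s\<close>, \<open>nxt s\<close>, \<open>nxt (nxt s)\<close>. The shift \<open>\<epsilon>\<^sup>2 \<delta>\<close> in the plane of the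
  triangle solves \<open>2 (P - Q) \<bullet> \<delta> = -(i\<^sup>2 + 1/4)\<close> and \<open>2 (P - R) \<bullet> \<delta> = -(j\<^sup>2 + 1/4)\<close>. Up to \<open>O(\<epsilon>\<^sup>4)\<close> this
  cancels what the values that two corners do not share contribute to their squared distance,
  and leaves \<open>1 + \<epsilon>\<^sup>2 ((j - i')\<^sup>2 - 1/2)\<close>.
\<close>

definition vertex :: "real \<Rightarrow> nat \<Rightarrow> nat \<Rightarrow> nat \<Rightarrow> nat \<Rightarrow> real" where
  "vertex \<epsilon> s i j c =
    (if c \<ge> 5 then 0
     else if s < 3 then
       base s c
       + \<epsilon>\<^sup>2 * (((real i)\<^sup>2 - (real j)\<^sup>2) / 2 * (base (nxt s) c - base (nxt (nxt s)) c)
              - ((real i)\<^sup>2 + (real j)\<^sup>2 + 1 / 2) / 2 * base s c)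
       + \<epsilon> * (if c = 2 + s then real i else if c = 2 + nxt s then real j else 0)
     else base s c + (if c = 4 then \<epsilon> * (1 + real (prod_encode (i, j))) else 0))"

lemmas sum5 = lessThan_nat_numeral lessThan_Suc

section \<open>Directions and inner products of the base points\<close>

lemma dir_norm: "(dir_x s)\<^sup>2 + (dir_y s)\<^sup>2 = 1"
proof -
  have "(dir_x s)\<^sup>2 \<le> 1" by (intro power_le_one) (auto simp: dir_x_def)
  thus ?thesis by (simp add: dir_y_def)
qed

lemma dir_eq: "(s - 3) div 2 = (t - 3) div 2 \<Longrightarrow> dir_x s = dir_x t \<and> dir_y s = dir_y t"
  by (simp add: dir_x_def dir_y_def)

lemma partner_props:
  assumes "s \<ge> 3"
  shows "partner s \<ge> 3" "odd (partner s) \<noteq> odd s" "(partner s - 3) div 2 = (s - 3) div 2"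
  using assms unfolding partner_def by (cases "odd s"; simp; presburger)+

lemma same_pair:
  assumes "s \<ge> 3" "t \<ge> 3" "(s - 3) div 2 = (t - 3) div 2"
  shows "t = s \<or> t = partner s"
proof -
  obtain a b where ab: "s = a + 3" "t = b + 3"
    using assms(1,2) by (metis add.commute le_Suc_ex)
  with assms(3) have "a div 2 = b div 2" by simp
  hence "b = a \<or> (even a \<and> b = a + 1) \<or> (odd a \<and> b + 1 = a)"
    by (cases "even a"; cases "even b") (auto elim!: evenE oddE)
  thus ?thesis using ab by (auto simp: partner_def)
qed

lemma dir_partner: "s \<ge> 3 \<Longrightarrow> dir_x (partner s) = dir_x s \<and> dir_y (partner s) = dir_y s"
  by (intro dir_eq partner_props(3))

text \<open>Strict Cauchy-Schwarz: by Lagrange's identity the squares of the inner product and of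
  the 2 by 2 determinant sum to 1, and the determinant is nonzero because it divides the difference
  of the squared first coordinates.\<close>

lemma dir_inner_less:
  assumes "(s - 3) div 2 \<noteq> (t - 3) div 2"
  shows "\<bar>dir_x s * dir_x t + dir_y s * dir_y t\<bar> < 1"
proof -
  let ?a = "dir_x s" and ?b = "dir_y s" and ?a' = "dir_x t" and ?b' = "dir_y t"
  have "?a \<noteq> ?a'" "?a > 0" "?a' > 0" using assms by (auto simp: dir_x_def)
  hence ne: "?a\<^sup>2 \<noteq> ?a'\<^sup>2" by (simp add: power2_eq_iff)
  have b: "?b\<^sup>2 = 1 - ?a\<^sup>2" "?b'\<^sup>2 = 1 - ?a'\<^sup>2" using dir_norm[of s] dir_norm[of t] by auto
  have "(?a * ?b' - ?a' * ?b) * (?a * ?b' + ?a' * ?b) = ?a\<^sup>2 * ?b'\<^sup>2 - ?a'\<^sup>2 * ?b\<^sup>2"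
    by (simp add: power2_eq_square algebra_simps)
  also have "\<dots> = ?a\<^sup>2 - ?a'\<^sup>2" unfolding b by (simp add: algebra_simps)
  finally have "?a\<^sup>2 - ?a'\<^sup>2 = (?a * ?b' - ?a' * ?b) * (?a * ?b' + ?a' * ?b)" ..
  hence "?a * ?b' - ?a' * ?b \<noteq> 0" using ne by auto
  hence "(?a * ?b' - ?a' * ?b)\<^sup>2 > 0" by simp
  moreover have "(?a * ?a' + ?b * ?b')\<^sup>2 + (?a * ?b' - ?a' * ?b)\<^sup>2 = 1"
  proof -
    have "(?a * ?a' + ?b * ?b')\<^sup>2 + (?a * ?b' - ?a' * ?b)\<^sup>2 = (?a\<^sup>2 + ?b\<^sup>2) * (?a'\<^sup>2 + ?b'\<^sup>2)"
      by (simp add: power2_eq_square algebra_simps)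
    thus ?thesis by (simp add: dir_norm)
  qed
  ultimately have "(?a * ?a' + ?b * ?b')\<^sup>2 < 1" by linarith
  thus ?thesis by (simp add: abs_square_less_1)
qed

definition gram :: "nat \<Rightarrow> nat \<Rightarrow> real" where "gram s t = (\<Sum>c<5. base s c * base t c)"

lemma gram_tri:
  assumes "s < 3" "t < 3"
  shows "gram s t = (if s = t then 1 / 3 else - 1 / 6)"
proof -
  have "s = 0 \<or> s = 1 \<or> s = 2" "t = 0 \<or> t = 1 \<or> t = 2" using assms by linarith+
  thus ?thesis by (elim disjE; simp add: gram_def sum5 base_def inradius_sq)
qed

lemma gram_mixed: "s < 3 \<Longrightarrow> t \<ge> 3 \<Longrightarrow> gram s t = 0" "s < 3 \<Longrightarrow> t \<ge> 3 \<Longrightarrow> gram t s = 0"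
  by (auto simp: gram_def sum5 base_def)

lemma gram_pair:
  assumes "s \<ge> 3" "t \<ge> 3"
  shows "gram s t = (if odd s = odd t then 1 else -1) * (dir_x s * dir_x t + dir_y s * dir_y t) / 4"
  using assms by (auto simp: gram_def sum5 base_def)

lemma gram_same: "s \<ge> 3 \<Longrightarrow> gram s s = 1 / 4"
  using dir_norm[of s] by (simp add: gram_pair power2_eq_square)

lemma gram_partner: "s \<ge> 3 \<Longrightarrow> gram s (partner s) = - 1 / 4"
proof -
  assume s: "s \<ge> 3"
  thus ?thesis using partner_props[OF s] dir_norm[of s] dir_partner[OF s] by (simp add: gram_pair power2_eq_square)
qed

lemma gram_pair_less:
  assumes "s \<ge> 3" "t \<ge> 3" "s \<noteq> t" "t \<noteq> partner s"
  shows "\<bar>gram s t\<bar> < 1 / 4"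
proof -
  have "(s - 3) div 2 \<noteq> (t - 3) div 2"
    using same_pair assms by blast
  from dir_inner_less[OF this] show ?thesis using assms by (auto simp: gram_pair abs_if split: if_splits)
qed

lemma sqdist5_scaled_base:
  "(\<Sum>c<5. (k * base s c - l * base t c)\<^sup>2) = k\<^sup>2 * gram s s + l\<^sup>2 * gram t t - 2 * k * l * gram s t"
  by (simp add: gram_def sum5 power2_eq_square algebra_simps)

section \<open>Distances in the limit of small \<epsilon>\<close>

lemma vertex_tendsto: "((\<lambda>\<epsilon>. vertex \<epsilon> s i j c) \<longlongrightarrow> (if c < 5 then base s c else 0)) (at_right 0)"
  unfolding vertex_def by (cases "c < 5"; cases "s < 3"; cases "c = 4") (auto intro!: tendsto_eq_intros)

lemma sqdist5_vertex_tendsto: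
  "((\<lambda>\<epsilon>. sqdist5 (vertex \<epsilon> s i j) (vertex \<epsilon> t i' j')) \<longlongrightarrow> gram s s + gram t t - 2 * gram s t) (at_right 0)"
proof -
  have "((\<lambda>\<epsilon>. sqdist5 (vertex \<epsilon> s i j) (vertex \<epsilon> t i' j')) \<longlongrightarrow>
      (\<Sum>c<5. ((if c < 5 then base s c else 0) - (if c < 5 then base t c else 0))\<^sup>2)) (at_right 0)"
    unfolding sqdist5_def by (intro tendsto_intros vertex_tendsto)
  also have "(\<Sum>c<5. ((if c < 5 then base s c else 0) - (if c < 5 then base t c else 0))\<^sup>2) =
      (\<Sum>c<5. (1 * base s c - 1 * base t c)\<^sup>2)" by (intro sum.cong) auto
  finally show ?thesis unfolding sqdist5_scaled_base by simp
qed

lemma sqdist5_antipode_tendsto: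
  "((\<lambda>\<epsilon>. sqdist5 (vertex \<epsilon> s i j) (antipode t)) \<longlongrightarrow>
    gram s s + (antipode_scale t)\<^sup>2 * gram t t + 2 * antipode_scale t * gram s t) (at_right 0)"
proof -
  have "((\<lambda>\<epsilon>. sqdist5 (vertex \<epsilon> s i j) (antipode t)) \<longlongrightarrow>
      (\<Sum>c<5. ((if c < 5 then base s c else 0) - antipode t c)\<^sup>2)) (at_right 0)"
    unfolding sqdist5_def by (intro tendsto_intros vertex_tendsto)
  also have "(\<Sum>c<5. ((if c < 5 then base s c else 0) - antipode t c)\<^sup>2) =
      (\<Sum>c<5. (1 * base s c - (- antipode_scale t) * base t c)\<^sup>2)"
    by (intro sum.cong) (auto simp: antipode_def)
  finally show ?thesis unfolding sqdist5_scaled_base by simp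
qed

lemma sqdist5_antipodes_le: "s \<noteq> t \<Longrightarrow> sqdist5 (antipode s) (antipode t) \<le> 1"
proof -
  assume "s \<noteq> t"
  have "sqdist5 (antipode s) (antipode t) =
      (\<Sum>c<5. ((- antipode_scale s) * base s c - (- antipode_scale t) * base t c)\<^sup>2)"
    unfolding sqdist5_def by (intro sum.cong) (auto simp: antipode_def)
  also have "\<dots> = (antipode_scale s)\<^sup>2 * gram s s + (antipode_scale t)\<^sup>2 * gram t t
      - 2 * antipode_scale s * antipode_scale t * gram s t"
    unfolding sqdist5_scaled_base by simp
  also have "\<dots> \<le> 1"
  proof (cases "s < 3 \<or> t < 3")
    case True
    thus ?thesis using \<open>s \<noteq> t\<close>
      by (cases "s < 3"; cases "t < 3")
        (auto simp: gram_tri gram_mixed gram_same antipode_scale_def power2_eq_square)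
  next
    case False
    thus ?thesis
      using gram_pair_less[of s t] gram_partner[of s] \<open>s \<noteq> t\<close>
      by (cases "t = partner s") (auto simp: gram_same antipode_scale_def)
  qed
  finally show ?thesis .
qed

text \<open>The limit is strictly below 1. Two corners, or the two ends of a diameter, have limit
  exactly 1 and need the exact expansions below.\<close>

lemma eventually_vertices_near:
  assumes "s \<noteq> t" "s \<ge> 3 \<or> t \<ge> 3" "s \<ge> 3 \<Longrightarrow> t \<noteq> partner s"
  shows "\<forall>\<^sub>F \<epsilon> in at_right 0. sqdist5 (vertex \<epsilon> s i j) (vertex \<epsilon> t i' j') \<le> 1"
proof -
  have "gram s s + gram t t - 2 * gram s t < 1"
    using assms gram_pair_less[of s t]
    by (cases "s < 3"; cases "t < 3") (auto simp: gram_tri gram_mixed gram_same)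
  from order_tendstoD(2)[OF sqdist5_vertex_tendsto[of s i j t i' j'] this] show ?thesis
    by (rule eventually_mono) simp
qed

lemma eventually_antipode_near:
  assumes "s \<noteq> t"
  shows "\<forall>\<^sub>F \<epsilon> in at_right 0. sqdist5 (vertex \<epsilon> s i j) (antipode t) \<le> 1"
proof -
  have "gram s s + (antipode_scale t)\<^sup>2 * gram t t + 2 * antipode_scale t * gram s t < 1"
  proof (cases "s < 3 \<or> t < 3")
    case True
    thus ?thesis using assms
      by (cases "s < 3"; cases "t < 3")
        (auto simp: gram_tri gram_mixed gram_same antipode_scale_def power2_eq_square)
  next
    case False
    thus ?thesis
      using gram_pair_less[of s t] gram_partner[of s] assms
      by (cases "t = partner s") (auto simp: gram_same antipode_scale_def)
  qed
  from order_tendstoD(2)[OF sqdist5_antipode_tendsto[of s i j t] this] show ?thesis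
    by (rule eventually_mono) simp
qed

text \<open>The base points are exactly 1 apart and the perturbation is orthogonal to the circle, so
  any difference of codes pushes the points too far apart. Injectivity of \<open>prod_encode\<close>
  lets one coordinate compare both values.\<close>

lemma sqdist5_partner:
  assumes "s \<ge> 3"
  shows "sqdist5 (vertex \<epsilon> s i j) (vertex \<epsilon> (partner s) i' j') =
    1 + \<epsilon>\<^sup>2 * (real (prod_encode (i, j)) - real (prod_encode (i', j')))\<^sup>2"
proof -
  note p = partner_props[OF assms]
  show ?thesis
    using assms p dir_norm[of s] dir_partner[OF assms]
    by (auto simp: sqdist5_def sum5 vertex_def base_def power2_eq_square algebra_simps)
qed

text \<open>The antipode has last coordinate 0; the summand 1 keeps the vertex away from it even for
  code 0.\<close>

lemma sqdist5_antipode_pair: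
  assumes "s \<ge> 3"
  shows "sqdist5 (vertex \<epsilon> s i j) (antipode s) = 1 + \<epsilon>\<^sup>2 * (1 + real (prod_encode (i, j)))\<^sup>2"
  using assms dir_norm[of s]
  by (auto simp: sqdist5_def sum5 vertex_def antipode_def antipode_scale_def base_def
      power2_eq_square algebra_simps)

text \<open>For a corner the limit is (7/4)^2 / 3 = 49/48. On the circle the limit is exactly 1, and
  the exact formula gives strictness.\<close>

lemma eventually_antipode_far:
  "\<forall>\<^sub>F \<epsilon> in at_right 0. sqdist5 (vertex \<epsilon> s i j) (antipode s) > 1"
proof (cases "s < 3")
  case True
  hence "gram s s + (antipode_scale s)\<^sup>2 * gram s s + 2 * antipode_scale s * gram s s > 1"
    by (simp add: gram_tri antipode_scale_def power2_eq_square)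
  from order_tendstoD(1)[OF sqdist5_antipode_tendsto[of s i j s] this] show ?thesis .
next
  case False
  have "\<forall>\<^sub>F \<epsilon>::real in at_right 0. \<epsilon> > 0" by (simp add: eventually_at_right_less)
  thus ?thesis
  proof (rule eventually_mono)
    fix \<epsilon> :: real assume "\<epsilon> > 0"
    hence "\<epsilon>\<^sup>2 * (1 + real (prod_encode (i, j)))\<^sup>2 > 0" by simp
    thus "sqdist5 (vertex \<epsilon> s i j) (antipode s) > 1"
      using False by (simp add: sqdist5_antipode_pair)
  qed
qed

text \<open>The shift in the plane of the triangle cancels the squares of the unshared values
  \<open>i\<close> and \<open>j'\<close> at order two; the square of the shift difference goes into
  \<open>E\<close>.\<close>

lemma sqdist5_nxt:
  assumes "s < 3"
  shows "\<exists>E. \<forall>\<epsilon>. sqdist5 (vertex \<epsilon> s i j) (vertex \<epsilon> (nxt s) i' j') =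
    1 + \<epsilon>\<^sup>2 * ((real j - real i')\<^sup>2 - 1 / 2) + \<epsilon> ^ 4 * E"
proof -
  define shift where "shift s i j c =
    ((real i)\<^sup>2 - (real j)\<^sup>2) / 2 * (base (nxt s) c - base (nxt (nxt s)) c)
      - ((real i)\<^sup>2 + (real j)\<^sup>2 + 1 / 2) / 2 * base s c" for s i j c
  define P where "P c = base s c - base (nxt s) c" for c
  define Q where "Q c = shift s i j c - shift (nxt s) i' j' c" for c
  have cases_s: "s = 0 \<or> s = 1 \<or> s = 2" using assms by linarith
  have PP: "P 0 * P 0 + P 1 * P 1 = 1"
    using cases_s by (elim disjE; simp add: P_def base_def nxt_def inradius_sq)
  have PQ: "P 0 * Q 0 + P 1 * Q 1 = - ((real i)\<^sup>2 + (real j')\<^sup>2 + 1 / 2) / 2"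
    using cases_s
    by (elim disjE; simp add: P_def Q_def shift_def base_def nxt_def; simp add: algebra_simps inradius_sq; simp add: field_simps)
  have "sqdist5 (vertex \<epsilon> s i j) (vertex \<epsilon> (nxt s) i' j') =
      1 + \<epsilon>\<^sup>2 * ((real j - real i')\<^sup>2 - 1 / 2) + \<epsilon> ^ 4 * (Q 0 * Q 0 + Q 1 * Q 1)" for \<epsilon>
  proof -
    \<comment> \<open>Outside the plane, \<open>i\<close>, the shared pair \<open>j\<close>,
      \<open>i'\<close>, and \<open>j'\<close> occupy the coordinates 2, 3, 4 in cyclic order from
      \<open>2 + s\<close>.\<close>
    have "sqdist5 (vertex \<epsilon> s i j) (vertex \<epsilon> (nxt s) i' j') =
        (P 0 + \<epsilon>\<^sup>2 * Q 0)\<^sup>2 + (P 1 + \<epsilon>\<^sup>2 * Q 1)\<^sup>2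
        + ((\<epsilon> * real i)\<^sup>2 + (\<epsilon> * real j - \<epsilon> * real i')\<^sup>2 + (\<epsilon> * real j')\<^sup>2)"
      using cases_s
      by (elim disjE; simp add: sqdist5_def sum5 vertex_def shift_def P_def Q_def base_def nxt_def)
        (simp_all add: algebra_simps)
    also have "\<dots> = (P 0 * P 0 + P 1 * P 1) + 2 * \<epsilon>\<^sup>2 * (P 0 * Q 0 + P 1 * Q 1)
        + \<epsilon> ^ 4 * (Q 0 * Q 0 + Q 1 * Q 1)
        + \<epsilon>\<^sup>2 * ((real i)\<^sup>2 + (real j - real i')\<^sup>2 + (real j')\<^sup>2)"
      by (simp add: power2_eq_square power4_eq_xxxx algebra_simps)
    also have "\<dots> = 1 + \<epsilon>\<^sup>2 * ((real j - real i')\<^sup>2 - 1 / 2) + \<epsilon> ^ 4 * (Q 0 * Q 0 + Q 1 * Q 1)"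
      unfolding PP PQ by (simp add: field_simps)
    finally show ?thesis .
  qed
  thus ?thesis by blast
qed

text \<open>The coefficient of order two is -1/2 for equal values and at least 1/2 for distinct
  natural numbers, so the term of order four cannot change the sign once \<epsilon> is
  small.\<close>

lemma eventually_triangle:
  assumes "s < 3"
  shows "\<forall>\<^sub>F \<epsilon> in at_right 0. sqdist5 (vertex \<epsilon> s i j) (vertex \<epsilon> (nxt s) i' j') \<le> 1 \<longleftrightarrow> j = i'"
proof -
  define k where "k = (real j - real i')\<^sup>2 - 1 / 2"
  from sqdist5_nxt[OF assms] obtain E where
    E: "\<And>\<epsilon>. sqdist5 (vertex \<epsilon> s i j) (vertex \<epsilon> (nxt s) i' j') = 1 + \<epsilon>\<^sup>2 * k + \<epsilon> ^ 4 * E"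
    unfolding k_def by metis
  have E': "sqdist5 (vertex \<epsilon> s i j) (vertex \<epsilon> (nxt s) i' j') = 1 + \<epsilon>\<^sup>2 * (k + \<epsilon>\<^sup>2 * E)" for \<epsilon>
    unfolding E by (simp add: algebra_simps power4_eq_xxxx power2_eq_square)
  have lim: "((\<lambda>\<epsilon>. k + \<epsilon>\<^sup>2 * E) \<longlongrightarrow> k) (at_right 0)" by (auto intro!: tendsto_eq_intros)
  have pos: "\<forall>\<^sub>F \<epsilon>::real in at_right 0. \<epsilon> > 0" by (simp add: eventually_at_right_less)
  show ?thesis
  proof (cases "j = i'")
    case True
    hence "k < 0" by (simp add: k_def)
    from order_tendstoD(2)[OF lim this] show ?thesis
    proof (rule eventually_mono)
      fix \<epsilon> assume "k + \<epsilon>\<^sup>2 * E < 0"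
      hence "\<epsilon>\<^sup>2 * (k + \<epsilon>\<^sup>2 * E) \<le> 0" by (simp add: mult_le_0_iff)
      thus "sqdist5 (vertex \<epsilon> s i j) (vertex \<epsilon> (nxt s) i' j') \<le> 1 \<longleftrightarrow> j = i'"
        unfolding E' using True by simp
    qed
  next
    case False
    hence "(real j - real i')\<^sup>2 \<ge> 1"
      using one_le_power[of "\<bar>real j - real i'\<bar>" 2] by (auto simp: neq_iff)
    hence "k > 0" by (simp add: k_def)
    from order_tendstoD(1)[OF lim this] pos show ?thesis
      by eventually_elim (use False in \<open>auto simp: E' mult_le_0_iff\<close>)
  qed
qed

section \<open>Betti numbers of Vietoris-Rips complexes\<close>

lemma vietoris_rips_eq_clique_complex:
  assumes "finite S"
  shows "vietoris_rips d S = clique_complex S (\<lambda>u w. euclidean_dist d u w \<le> 1)"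
proof -
  have "euclidean_diameter d \<sigma> \<le> 1 \<longleftrightarrow> (\<forall>u\<in>\<sigma>. \<forall>w\<in>\<sigma>. euclidean_dist d u w \<le> 1)"
    if "\<sigma> \<subseteq> S" for \<sigma>
  proof (cases "\<sigma> = {}")
    case False
    have "finite \<sigma>" using finite_subset[OF that assms] .
    hence "bdd_above ((\<lambda>(x, y). euclidean_dist d x y) ` (\<sigma> \<times> \<sigma>))" by (intro bdd_above_finite) auto
    hence "(SUP (x, y)\<in>\<sigma> \<times> \<sigma>. euclidean_dist d x y) \<le> 1 \<longleftrightarrow>
        (\<forall>z\<in>\<sigma> \<times> \<sigma>. (case z of (x, y) \<Rightarrow> euclidean_dist d x y) \<le> 1)"
      using False by (intro cSUP_le_iff) auto
    with False show ?thesis by (auto simp: euclidean_diameter_def)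
  qed (simp add: euclidean_diameter_def)
  thus ?thesis unfolding vietoris_rips_def clique_complex_def by blast
qed

text \<open>Infinitely many sets compete under \<open>Max\<close>, but their Betti numbers are
  bounded by a power of \<open>n\<close> and so form a finite set.\<close>

lemma reduced_betti_le_max_rips_betti:
  assumes "S \<subseteq> topspace (Euclidean_space d)" "finite S" "card S \<le> n"
  shows "reduced_betti TYPE('k::field) p (vietoris_rips d S) \<le> max_rips_betti TYPE('k) p d n"
  unfolding max_rips_betti_def
proof (rule Max_ge)
  let ?M = "{reduced_betti TYPE('k) p (vietoris_rips d S) | S.
    S \<subseteq> topspace (Euclidean_space d) \<and> finite S \<and> card S \<le> n}"
  have "reduced_betti TYPE('k) p (vietoris_rips d S) \<le> n ^ (p + 1)"
    if "finite S" "card S \<le> n" for S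
  proof -
    have "reduced_betti TYPE('k) p (vietoris_rips d S) \<le> card S ^ (p + 1)"
      unfolding vietoris_rips_eq_clique_complex[OF that(1)]
      by (rule finite_complex.reduced_betti_le[OF finite_complex_clique_complex[OF that(1)]])
    also have "\<dots> \<le> n ^ (p + 1)" using that(2) by (intro power_mono) auto
    finally show ?thesis .
  qed
  hence "?M \<subseteq> {..n ^ (p + 1)}" by auto
  thus "finite ?M" by (rule finite_subset) simp
  show "reduced_betti TYPE('k) p (vietoris_rips d S) \<in> ?M" using assms by blast
qed

lemma euclidean_dist_le_1_iff:
  assumes "d \<ge> 5" "\<forall>c\<ge>5. x c = 0" "\<forall>c\<ge>5. y c = 0"
  shows "euclidean_dist d x y \<le> 1 \<longleftrightarrow> sqdist5 x y \<le> 1"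
proof -
  have "(\<Sum>c<d. (x c - y c)\<^sup>2) = (\<Sum>c<5. (x c - y c)\<^sup>2)"
    using assms by (intro sum.mono_neutral_right) auto
  thus ?thesis by (simp add: euclidean_dist_def L2_set_def sqdist5_def)
qed

lemma sqdist5_commute: "sqdist5 x y = sqdist5 y x"
  by (simp add: sqdist5_def power2_commute)

lemma eventually_imp_const: "(A \<Longrightarrow> eventually P F) \<Longrightarrow> eventually (\<lambda>x. A \<longrightarrow> P x) F"
  by (cases A) auto

text \<open>Finitely many conditions, each true for all small positive \<epsilon>, have a common
  solution. The condition on partners is not listed, as it holds for every positive
  \<epsilon>.\<close>

lemma exists_perturbation:
  assumes "finite T"
  shows "\<exists>\<epsilon>>0. \<forall>s\<in>T. \<forall>t\<in>T. \<forall>i\<in>{..<m}. \<forall>j\<in>{..<m}. \<forall>i'\<in>{..<m}. \<forall>j'\<in>{..<m}.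
    (s \<noteq> t \<and> (s \<ge> 3 \<or> t \<ge> 3) \<and> (s \<ge> 3 \<longrightarrow> t \<noteq> partner s) \<longrightarrow>
       sqdist5 (vertex \<epsilon> s i j) (vertex \<epsilon> t i' j') \<le> 1) \<and>
    (s \<noteq> t \<longrightarrow> sqdist5 (vertex \<epsilon> s i j) (antipode t) \<le> 1) \<and>
    sqdist5 (vertex \<epsilon> s i j) (antipode s) > 1 \<and>
    (s < 3 \<longrightarrow> (sqdist5 (vertex \<epsilon> s i j) (vertex \<epsilon> (nxt s) i' j') \<le> 1 \<longleftrightarrow> j = i'))"
    (is "\<exists>\<epsilon>>0. ?P \<epsilon>")
proof -
  have "eventually ?P (at_right 0)"
    by (intro eventually_ball_finite ballI eventually_conj eventually_imp_const assms finite_lessThan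
        eventually_vertices_near eventually_antipode_near eventually_antipode_far eventually_triangle) auto
  moreover have "\<forall>\<^sub>F \<epsilon>::real in at_right 0. \<epsilon> > 0" by (simp add: eventually_at_right_less)
  ultimately have "\<forall>\<^sub>F \<epsilon> in at_right 0. \<epsilon> > 0 \<and> ?P \<epsilon>" by (intro eventually_conj)
  from eventually_happens'[OF _ this] show ?thesis by simp
qed

lemma vertex_support: "\<forall>c\<ge>5. vertex \<epsilon> s i j c = 0" and antipode_support: "\<forall>c\<ge>5. antipode s c = 0"
  by (simp_all add: vertex_def antipode_def)

lemma nxt_props:
  assumes "s < 3"
  shows "nxt s < 3" "nxt (nxt (nxt s)) = s" "t < 3 \<Longrightarrow> t \<noteq> s \<Longrightarrow> t = nxt s \<or> t = nxt (nxt s)"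
proof -
  have "s = 0 \<or> s = 1 \<or> s = 2" using assms by linarith
  thus "nxt s < 3" "nxt (nxt (nxt s)) = s" "t < 3 \<Longrightarrow> t \<noteq> s \<Longrightarrow> t = nxt s \<or> t = nxt (nxt s)"
    by (elim disjE; simp add: nxt_def; linarith)+
qed

text \<open>The first of the two positions of \<open>f\<close> that a vertex of type
  \<open>s\<close> remembers. Both ends of a diameter store the same positions in the same
  order.\<close>

definition fst_index :: "nat \<Rightarrow> nat" where
  "fst_index s = (if s < 3 \<or> odd s then s else s - 1)"

definition snd_index :: "nat \<Rightarrow> nat" where
  "snd_index s = (if s < 3 then nxt s else if odd s then s + 1 else s)"

lemma index_partner:
  assumes "s \<ge> 3"
  shows "fst_index (partner s) = fst_index s" "snd_index (partner s) = snd_index s"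
    "{fst_index s, snd_index s} = {s, partner s}"
  using assms partner_props(1,2)[OF assms]
  by (auto simp: fst_index_def snd_index_def partner_def split: if_splits)

text \<open>Each of the \<open>p + 1\<close> types costs \<open>m\<^sup>2\<close> vertices and one
  antipode, while the faces are as many as the functions \<open>f\<close>.\<close>

lemma rips_many_cross_polytopes:
  assumes p: "p > 0" and d: "d \<ge> 5"
  shows "\<exists>S \<subseteq> topspace (Euclidean_space d). finite S \<and> card S \<le> (p + 1) * (m\<^sup>2 + 1) \<and>
    m ^ (p + 1) \<le> reduced_betti TYPE('k::field) p (vietoris_rips d S)"
proof -
  \<comment> \<open>For odd \<open>p\<close> the types \<open>3,\<dots>,p + 3\<close> omit the triangle.\<close>
  define t0 :: nat where "t0 = (if even p then 0 else 3)"
  define T where "T = {t0..t0 + p}"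
  have finT: "finite T" and cardT: "card T = p + 1" by (simp_all add: T_def)
  \<comment> \<open>An even positive \<open>p\<close> is at least 2, so the triangle is complete;
    for odd \<open>p\<close> no type is below 3.\<close>
  have nxt_T: "nxt s \<in> T" if "s \<in> T" "s < 3" for s
    using that p nxt_props(1)[of s] by (auto simp: T_def t0_def split: if_splits elim!: evenE)
  have partner_T: "partner s \<in> T" if "s \<in> T" "s \<ge> 3" for s
  proof -
    \<comment> \<open>The last type is even for either parity of \<open>p\<close>, so no diameter
      loses an end.\<close>
    have "even (t0 + p)" "t0 \<le> 3" by (auto simp: t0_def)
    moreover have "partner s \<le> t0 + p"
    proof (cases "odd s")
      case True
      hence "s \<noteq> t0 + p" using \<open>even (t0 + p)\<close> by blast
      thus ?thesis using that(1) True by (simp add: T_def partner_def)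
    qed (use that(1) in \<open>auto simp: T_def partner_def\<close>)
    ultimately show ?thesis using partner_props(1)[OF that(2)] by (simp add: T_def)
  qed
  have index_T: "fst_index s \<in> T" "snd_index s \<in> T" if "s \<in> T" for s
    using that nxt_T[of s] partner_T[of s] index_partner(3)[of s]
    by (cases "s < 3"; auto simp: fst_index_def snd_index_def doubleton_eq_iff split: if_splits)+
  obtain \<epsilon> where \<epsilon>: "\<epsilon> > 0" and good:
    "\<forall>s\<in>T. \<forall>t\<in>T. \<forall>i\<in>{..<m}. \<forall>j\<in>{..<m}. \<forall>i'\<in>{..<m}. \<forall>j'\<in>{..<m}.
      (s \<noteq> t \<and> (s \<ge> 3 \<or> t \<ge> 3) \<and> (s \<ge> 3 \<longrightarrow> t \<noteq> partner s) \<longrightarrow>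
         sqdist5 (vertex \<epsilon> s i j) (vertex \<epsilon> t i' j') \<le> 1) \<and>
      (s \<noteq> t \<longrightarrow> sqdist5 (vertex \<epsilon> s i j) (antipode t) \<le> 1) \<and>
      sqdist5 (vertex \<epsilon> s i j) (antipode s) > 1 \<and>
      (s < 3 \<longrightarrow> (sqdist5 (vertex \<epsilon> s i j) (vertex \<epsilon> (nxt s) i' j') \<le> 1 \<longleftrightarrow> j = i'))"
    using exists_perturbation[OF finT, of m] by blast
  define adj where "adj u w \<longleftrightarrow> sqdist5 u w \<le> 1" for u w
  have sym: "adj u w \<longleftrightarrow> adj w u" for u w by (simp add: adj_def sqdist5_commute)
  have near: "adj (vertex \<epsilon> s i j) (vertex \<epsilon> t i' j')"
    if "s \<in> T" "t \<in> T" "i < m" "j < m" "i' < m" "j' < m" "s \<noteq> t" "s \<ge> 3 \<or> t \<ge> 3" "s \<ge> 3 \<longrightarrow> t \<noteq> partner s"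
    for s t i j i' j' using good that unfolding adj_def by simp
  have near_antipode: "adj (vertex \<epsilon> s i j) (antipode t)"
    if "s \<in> T" "t \<in> T" "i < m" "j < m" "s \<noteq> t" for s t i j
    using good that unfolding adj_def by blast
  have far_antipode: "\<not> adj (vertex \<epsilon> s i j) (antipode s)"
    if "s \<in> T" "i < m" "j < m" for s i j
    using good that unfolding adj_def not_le by blast
  have triangle: "adj (vertex \<epsilon> s i j) (vertex \<epsilon> (nxt s) i' j') \<longleftrightarrow> j = i'"
    if "s \<in> T" "i < m" "j < m" "i' < m" "j' < m" "s < 3" for s i j i' j'
    using good that unfolding adj_def by blast
  have pair: "adj (vertex \<epsilon> s i j) (vertex \<epsilon> (partner s) i' j') \<longleftrightarrow> (i, j) = (i', j')"
    if "s \<ge> 3" for s i j i' j'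
    using \<epsilon> prod_encode_eq[of "(i, j)" "(i', j')"]
    by (auto simp: adj_def sqdist5_partner[OF that] mult_le_0_iff)

  define I where "I = (PiE T (\<lambda>_. {..<m}))"
  have f_less: "f s < m" if "f \<in> I" "s \<in> T" for f s using that by (auto simp: I_def)
  define V where "V f s = vertex \<epsilon> s (f (fst_index s)) (f (snd_index s))" for f s
  define S where "S = (\<lambda>(s, i, j). vertex \<epsilon> s i j) ` (T \<times> {..<m} \<times> {..<m}) \<union> antipode ` T"
  have finS: "finite S" using finT by (simp add: S_def)
  have VS: "V f s \<in> S" if "f \<in> I" "s \<in> T" for f s
  proof -
    have mem: "(s, f (fst_index s), f (snd_index s)) \<in> T \<times> {..<m} \<times> {..<m}"
      using that f_less index_T by auto
    show ?thesis unfolding V_def S_def by (intro UnI1 image_eqI[OF _ mem]) simp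
  qed
  have "card S \<le> card (T \<times> {..<m} \<times> {..<m}) + card T"
    unfolding S_def
    by (intro order_trans[OF card_Un_le] add_mono card_image_le finT finite_cartesian_product finite_lessThan)
  also have "\<dots> = (p + 1) * (m\<^sup>2 + 1)"
    by (simp add: cardT card_cartesian_product power2_eq_square algebra_simps)
  finally have cardS: "card S \<le> (p + 1) * (m\<^sup>2 + 1)" .
  have supp: "\<forall>c\<ge>5. x c = 0" if "x \<in> S" for x
    using that vertex_support antipode_support by (auto simp: S_def)
  have rips: "vietoris_rips d S = clique_complex S adj"
    unfolding vietoris_rips_eq_clique_complex[OF finS] clique_complex_def adj_def
    using euclidean_dist_le_1_iff[OF d supp supp] by (intro Collect_cong) (metis subsetD)

  \<comment> \<open>The second value at \<open>s\<close> and the first value at \<open>nxt s\<close>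
    are both read from position \<open>nxt s\<close>.\<close>
  have V_tri: "adj (V f s) (V g (nxt s)) \<longleftrightarrow> f (nxt s) = g (nxt s)"
    if "f \<in> I" "g \<in> I" "s \<in> T" "s < 3" for f g s
    unfolding V_def
    by (subst triangle)
      (use that index_T f_less nxt_T nxt_props(1)[OF that(4)] in \<open>auto simp: snd_index_def fst_index_def\<close>)
  have V_pair: "adj (V f s) (V g (partner s)) \<longleftrightarrow>
      f (fst_index s) = g (fst_index s) \<and> f (snd_index s) = g (snd_index s)"
    if "s \<ge> 3" for f g s
    unfolding V_def index_partner(1,2)[OF that] by (subst pair[OF that]) simp

  \<comment> \<open>Borderline pairs are adjacent because vertices of one face read their shared
    values from the same \<open>f\<close>.\<close>
  have VV: "adj (V f s) (V f t)" if f: "f \<in> I" and s: "s \<in> T" and t: "t \<in> T" and "s \<noteq> t" for f s t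
  proof -
    consider "s < 3" "t < 3" | "s \<ge> 3" "t = partner s" | "s \<ge> 3 \<or> t \<ge> 3" "s \<ge> 3 \<longrightarrow> t \<noteq> partner s"
      by linarith
    thus ?thesis
    proof cases
      case 1
      then consider "t = nxt s" | "s = nxt t" using nxt_props(3)[of s t] nxt_props(2)[of s] \<open>s \<noteq> t\<close> by metis
      thus ?thesis using V_tri[OF f f] s t 1 sym by cases auto
    next
      case 2
      thus ?thesis using V_pair by simp
    next
      case 3
      thus ?thesis unfolding V_def using s t \<open>s \<noteq> t\<close> f_less[OF f] index_T by (intro near) auto
    qed
  qed

  have "card I \<le> reduced_betti TYPE('k) p (clique_complex S adj)"
  proof (rule cross_polytope_betti_bound[where v = "\<lambda>f r. V f (t0 + r)" and x = "\<lambda>r. antipode (t0 + r)"])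
    show "finite I" unfolding I_def using finT by (intro finite_PiE) auto
    show "adj u u" for u by (simp add: adj_def sqdist5_def)
    show "adj w u" if "adj u w" for u w using that sym by blast
  next
    fix f s assume f: "f \<in> I" and s: "s \<le> p"
    hence sT: "t0 + s \<in> T" by (simp add: T_def)
    show "V f (t0 + s) \<in> S" using VS[OF f sT] .
    show "\<not> adj (V f (t0 + s)) (antipode (t0 + s))"
      unfolding V_def using sT f_less[OF f] index_T by (intro far_antipode) auto
    fix t assume "t \<le> p" and "s \<noteq> t"
    hence tT: "t0 + t \<in> T" and ne: "t0 + s \<noteq> t0 + t" by (simp_all add: T_def)
    show "adj (V f (t0 + s)) (V f (t0 + t))" by (rule VV[OF f sT tT ne])
    show "adj (V f (t0 + s)) (antipode (t0 + t))"
      unfolding V_def using sT tT ne f_less[OF f] index_T by (intro near_antipode) auto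
  next
    fix s t assume "s \<le> p" "t \<le> p" "s \<noteq> t"
    thus "adj (antipode (t0 + s)) (antipode (t0 + t))"
      unfolding adj_def by (intro sqdist5_antipodes_le) simp
  next
    fix f g assume f: "f \<in> I" and g: "g \<in> I" and "f \<noteq> g"
    then obtain s where s: "s \<in> T" "f s \<noteq> g s" unfolding I_def by (meson PiE_ext)
    have "\<exists>a\<in>T. \<exists>b\<in>T. \<not> adj (V f a) (V g b)"
    proof (cases "s < 3")
      case True
      \<comment> \<open>The corner before \<open>s\<close>, so that the value shared by
        \<open>a\<close> and \<open>nxt a\<close> is the one at \<open>s\<close>.\<close>
      define a where "a = nxt (nxt s)"
      have "a \<in> T" "a < 3" "nxt a = s"
        using True s nxt_T nxt_props by (auto simp: a_def)
      thus ?thesis using V_tri[OF f g, of a] s by metis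
    next
      case False
      hence "s = fst_index s \<or> s = snd_index s" using index_partner(3)[of s] by auto
      hence "\<not> adj (V f s) (V g (partner s))" using False V_pair[of s f g] s by auto
      thus ?thesis using s partner_T False by force
    qed
    then obtain a b where ab: "a \<in> T" "b \<in> T" "\<not> adj (V f a) (V g b)" by blast
    show "\<exists>s\<le>p. \<exists>t\<le>p. \<not> adj (V f (t0 + s)) (V g (t0 + t))"
      using ab by (intro exI[of _ "a - t0"] conjI exI[of _ "b - t0"]) (auto simp: T_def)
  next
    fix f w assume f: "f \<in> I" and "w \<in> S" and "\<forall>s\<le>p. adj w (V f (t0 + s))"
    hence w: "adj w (V f s)" if "s \<in> T" for s
      using that by (auto simp: T_def le_iff_add)
    have "\<exists>s\<in>T. w = V f s"
    proof -
      from \<open>w \<in> S\<close> consider s where "s \<in> T" "w = antipode s"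
        | s i j where "s \<in> T" "i < m" "j < m" "w = vertex \<epsilon> s i j" unfolding S_def by auto
      thus ?thesis
      proof cases
        case 1
        hence "\<not> adj w (V f s)"
          unfolding V_def using far_antipode[of s] f_less[OF f] index_T sym by blast
        thus ?thesis using w 1 by blast
      next
        case 2
        \<comment> \<open>The face determines \<open>w\<close>: adjacency to the next corner fixes
          \<open>j\<close> and to the preceding corner \<open>i\<close>; on the circle, adjacency to
          the partner fixes both.\<close>
        have "i = f (fst_index s) \<and> j = f (snd_index s)"
        proof (cases "s < 3")
          case True
          define a where "a = nxt (nxt s)"
          have a: "a \<in> T" "a < 3" "nxt a = s" and ns: "nxt s \<in> T" "nxt s < 3"
            using True 2 nxt_T nxt_props by (auto simp: a_def)
          have "adj (vertex \<epsilon> s i j) (vertex \<epsilon> (nxt s) (f (nxt s)) (f (nxt (nxt s))))"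
            using w[OF ns(1)] ns 2 by (simp add: V_def fst_index_def snd_index_def)
          hence "j = f (nxt s)"
            using triangle[of s i j "f (nxt s)" "f (nxt (nxt s))"] True 2 f_less[OF f] ns a
            by (simp add: a_def)
          moreover have "adj (vertex \<epsilon> a (f a) (f s)) (vertex \<epsilon> (nxt a) i j)"
            using w[OF a(1)] a 2 sym by (simp add: V_def fst_index_def snd_index_def)
          hence "f s = i"
            using triangle[of a "f a" "f s" i j] 2 f_less[OF f] a by simp
          ultimately show ?thesis using True by (simp add: fst_index_def snd_index_def)
        next
          case False
          hence s3: "s \<ge> 3" by simp
          have "adj (vertex \<epsilon> s i j) (V f (partner s))" using w[OF partner_T[OF 2(1) s3]] 2 by simp
          thus ?thesis unfolding V_def index_partner(1,2)[OF s3] using pair[OF s3] by simp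
        qed
        thus ?thesis using 2 unfolding V_def by blast
      qed
    qed
    then obtain s where "s \<in> T" "w = V f s" ..
    thus "\<exists>s\<le>p. w = V f (t0 + s)" by (intro exI[of _ "s - t0"]) (auto simp: T_def)
  qed (use finS in \<open>auto simp: S_def T_def\<close>)
  moreover have "card I = m ^ (p + 1)" unfolding I_def using finT cardT by (simp add: card_PiE)
  moreover have "S \<subseteq> topspace (Euclidean_space d)"
    using supp d by (auto simp: topspace_Euclidean_space)
  ultimately show ?thesis using finS cardS rips by (intro exI[of _ S]) auto
qed

theorem theorem5p3:
  fixes p :: nat
  assumes "p > 0"
  shows "\<exists>C::real. C > 0 \<and>
    (\<forall>d\<ge>5. \<forall>\<^sub>F n in sequentially.
       real (max_rips_betti TYPE('k::field) p d n) \<ge> C * real n powr (real p / 2 + 1 / 2))"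
proof (intro exI conjI allI impI)
  \<comment> \<open>By \<open>m\<^sup>2 + 1 \<le> 2 * m\<^sup>2\<close> at most
    \<open>q * m\<^sup>2\<close> points are used. In \<open>C\<close> the further factor 2 pays for
    rounding \<open>sqrt (n / q)\<close> down to \<open>m\<close>; only \<open>p\<close> enters, so
    \<open>C\<close> serves all \<open>d\<close>.\<close>
  define q where "q = 2 * (real p + 1)"
  define C where "C = (1 / (2 * sqrt q)) ^ (p + 1)"
  have q: "q > 0" by (simp add: q_def)
  show "C > 0" using q by (simp add: C_def)
  fix d :: nat assume d: "d \<ge> 5"
  have "C * real n powr (real p / 2 + 1 / 2) \<le> real (max_rips_betti TYPE('k) p d n)"
    \<comment> \<open>The threshold is \<open>4 * q\<close>; it gives \<open>a \<ge> 2\<close>, so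
      that rounding down loses at most half of \<open>a\<close>.\<close>
    if n: "n \<ge> 8 * (p + 1)" for n
  proof -
    define a where "a = sqrt (real n / q)"
    define m where "m = nat \<lfloor>a\<rfloor>"
    have "real n \<ge> 4 * q" using n by (simp add: q_def flip: of_nat_le_iff)
    hence "real n / q \<ge> 2\<^sup>2" using q by (simp add: field_simps)
    hence a: "a \<ge> 2" unfolding a_def by (rule real_le_rsqrt)
    have m_le: "real m \<le> a" and m_ge: "a / 2 \<le> real m" and m1: "m \<ge> 1"
      using a unfolding m_def by linarith+
    have "(real m)\<^sup>2 \<le> a\<^sup>2" using m_le by (intro power_mono) auto
    also have "a\<^sup>2 = real n / q" using q by (simp add: a_def)
    finally have "q * (real m)\<^sup>2 \<le> real n" using q by (simp add: field_simps)
    hence "real (2 * (p + 1) * m\<^sup>2) \<le> real n" by (simp add: q_def algebra_simps)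
    hence "2 * (p + 1) * m\<^sup>2 \<le> n" by (simp only: of_nat_le_iff)
    moreover have "(p + 1) * (m\<^sup>2 + 1) \<le> (p + 1) * (2 * m\<^sup>2)" using m1 by (intro mult_left_mono) auto
    ultimately have size: "(p + 1) * (m\<^sup>2 + 1) \<le> n" by (simp only: mult.assoc mult.left_commute)
    obtain S where S: "S \<subseteq> topspace (Euclidean_space d)" "finite S" "card S \<le> (p + 1) * (m\<^sup>2 + 1)"
      "m ^ (p + 1) \<le> reduced_betti TYPE('k) p (vietoris_rips d S)"
      using rips_many_cross_polytopes[OF assms d, of m, where ?'k = 'k] by blast
    have "real n powr (real p / 2 + 1 / 2) = (real n powr (1 / 2)) powr real (p + 1)"
      unfolding powr_powr by (simp add: field_simps)
    also have "\<dots> = sqrt (real n) ^ (p + 1)"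
      using n by (subst powr_realpow) (auto simp: powr_half_sqrt)
    finally have "C * real n powr (real p / 2 + 1 / 2) = (a / 2) ^ (p + 1)"
      unfolding C_def a_def by (simp only: flip: power_mult_distrib) (simp add: real_sqrt_divide mult.commute)
    also have "\<dots> \<le> real m ^ (p + 1)" using m_ge a by (intro power_mono) auto
    also have "\<dots> = real (m ^ (p + 1))" by simp
    also have "\<dots> \<le> real (max_rips_betti TYPE('k) p d n)"
      using S(4) reduced_betti_le_max_rips_betti[OF S(1,2) order_trans[OF S(3) size], where ?'k = 'k and p = p]
      by (simp only: of_nat_le_iff)
    finally show ?thesis .
  qed
  thus "\<forall>\<^sub>F n in sequentially. C * real n powr (real p / 2 + 1 / 2) \<le> real (max_rips_betti TYPE('k) p d n)"
    unfolding eventually_sequentially by blast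
qed

end
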